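(* Let $(R,\mathfrak{m},k)$ be a local ring of prime characteristic $p>0$ and let $x\in\mathfrak{m}$ be a regular element. If $H^i_{\mathfrak{m}}(R/xR)$, with its natural Frobenius action, is anti-nilpotent for all $i\ge 0$, then $x$ is a surjective element.
   Context: All rings are commutative and noetherian. A regular element is a nonzerodivisor. For an $R$-module $M$, $F_*M$ denotes the abelian group $M$ with $R$-module structure $r\cdot F_*m=F_*(r^pm)$. A Frobenius action on $M$ is an $R$-linear map $\rho\colon M\to F_*M$, i.e. an additive map with $\rho(ra)=r^p\rho(a)$. The natural Frobenius action on $H^i_{\mathfrak{m}}(R/xR)$ is the one induced by the Frobenius map of the ring $R/xR$. A submodule $N\subseteq M$ is $F$-compatible if $\rho(N)\subseteq F_*N$. A module $M$ with a Frobenius action $\rho$ is anti-nilpotent if for every $F$-compatible submodule $N\subseteq M$ the action induced by $\rho$ on $M/N$ is injective. A regular element $x\in\mathfrak{m}$ is a surjective element if for all $\ell>0$ and $i\ge 0$ the map $H^i_{\mathfrak{m}}(R/x^\ell R)\to H^i_{\mathfrak{m}}(R/xR)$ induced by the natural surjection $R/x^\ell R\to R/xR$ is surjective. *)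

theory Defs
  imports "HOL-Algebra.Algebra" "HOL-Computational_Algebra.Primes"
begin

section \<open>Local rings and regular elements\<close>

definition local_ring :: "('a, 'r) ring_scheme \<Rightarrow> 'a set \<Rightarrow> bool" where
  "local_ring R m \<longleftrightarrow> cring R \<and> noetherian_ring R \<and> maximalideal m R \<and>
     (\<forall>J. maximalideal J R \<longrightarrow> J = m)"

definition has_char :: "('a, 'r) ring_scheme \<Rightarrow> nat \<Rightarrow> bool" where
  "has_char R p \<longleftrightarrow> (\<forall>n::nat. [n] \<cdot>\<^bsub>R\<^esub> \<one>\<^bsub>R\<^esub> = \<zero>\<^bsub>R\<^esub> \<longleftrightarrow> p dvd n)"

definition regular_element :: "('a, 'r) ring_scheme \<Rightarrow> 'a \<Rightarrow> bool" where
  "regular_element R x \<longleftrightarrow> x \<in> carrier R \<and>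
     (\<forall>a\<in>carrier R. x \<otimes>\<^bsub>R\<^esub> a = \<zero>\<^bsub>R\<^esub> \<longrightarrow> a = \<zero>\<^bsub>R\<^esub>)"

definition ideal_radical :: "('a, 'r) ring_scheme \<Rightarrow> 'a set \<Rightarrow> 'a set" where
  "ideal_radical R I = {a \<in> carrier R. \<exists>n::nat. a [^]\<^bsub>R\<^esub> n \<in> I}"


section \<open>Quotients of modules and of rings\<close>

text \<open>
  The record type \<open>module\<close> of HOL-Algebra extends \<open>ring\<close>. Its fields \<open>mult\<close> and \<open>one\<close> have
  no meaning for a module and are left undefined, except where the module is an algebra.
\<close>

text \<open>
  The map \<open>M/N \<rightarrow> M'/N'\<close> induced by an additive map \<open>h: M \<rightarrow> M'\<close> with \<open>h ` N \<subseteq> N'\<close>; the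
  cosets in the union below are then all equal. Only \<open>M'\<close> and \<open>N'\<close> are needed to write it down.
\<close>

definition induced_map ::
  "('d, 'm) ring_scheme \<Rightarrow> 'd set \<Rightarrow> ('c \<Rightarrow> 'd) \<Rightarrow> 'c set \<Rightarrow> 'd set" where
  "induced_map M' N' h U = (\<Union>y\<in>U. N' +>\<^bsub>M'\<^esub> h y)"

definition quot_module ::
  "('a, 'c, 'm) module_scheme \<Rightarrow> 'c set \<Rightarrow> ('a, 'c set) module" where
  "quot_module M N =
    \<lparr>carrier = a_rcosets\<^bsub>M\<^esub> N, monoid.mult = undefined, one = undefined,
     ring.zero = N, ring.add = set_add M,
     smult = (\<lambda>r. induced_map M N (\<lambda>y. r \<odot>\<^bsub>M\<^esub> y))\<rparr>"

text \<open>The ring \<open>R/I\<close> as an \<open>R\<close>-algebra.\<close>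

definition quot_algebra :: "('a, 'r) ring_scheme \<Rightarrow> 'a set \<Rightarrow> ('a, 'a set) module" where
  "quot_algebra R I =
    \<lparr>carrier = carrier (R Quot I), monoid.mult = monoid.mult (R Quot I), one = monoid.one (R Quot I),
     ring.zero = ring.zero (R Quot I), ring.add = ring.add (R Quot I),
     smult = (\<lambda>r U. (I +>\<^bsub>R\<^esub> r) \<otimes>\<^bsub>R Quot I\<^esub> U)\<rparr>"

text \<open>The natural surjection \<open>R/J \<rightarrow> R/I\<close> for ideals \<open>J \<subseteq> I\<close>.\<close>

definition quot_proj :: "('a, 'r) ring_scheme \<Rightarrow> 'a set \<Rightarrow> 'a set \<Rightarrow> 'a set" where
  "quot_proj R I = induced_map R I (\<lambda>a. a)"


section \<open>Localization of a module at the powers of an element\<close>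

text \<open>The pair \<open>(m, n)\<close> stands for the fraction \<open>m / f\<^sup>n\<close>.\<close>

definition loc_rel ::
  "('a, 'r) ring_scheme \<Rightarrow> 'a \<Rightarrow> ('a, 'c, 'm) module_scheme \<Rightarrow> (('c \<times> nat) \<times> ('c \<times> nat)) set"
where
  "loc_rel R f M = {((m, n), (m', n')). m \<in> carrier M \<and> m' \<in> carrier M \<and>
     (\<exists>k::nat. (f [^]\<^bsub>R\<^esub> (k + n')) \<odot>\<^bsub>M\<^esub> m = (f [^]\<^bsub>R\<^esub> (k + n)) \<odot>\<^bsub>M\<^esub> m')}"

definition loc_frac ::
  "('a, 'r) ring_scheme \<Rightarrow> 'a \<Rightarrow> ('a, 'c, 'm) module_scheme \<Rightarrow> 'c \<Rightarrow> nat \<Rightarrow> ('c \<times> nat) set"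
where
  "loc_frac R f M m n = loc_rel R f M `` {(m, n)}"

definition loc_module ::
  "('a, 'r) ring_scheme \<Rightarrow> 'a \<Rightarrow> ('a, 'c, 'm) module_scheme \<Rightarrow> ('a, ('c \<times> nat) set) module"
where
  "loc_module R f M =
    \<lparr>carrier = (carrier M \<times> UNIV) // loc_rel R f M, monoid.mult = undefined, one = undefined,
     ring.zero = loc_frac R f M \<zero>\<^bsub>M\<^esub> 0,
     ring.add = (\<lambda>U V. \<Union>(m, n)\<in>U. \<Union>(m', n')\<in>V. loc_frac R f M
       ((f [^]\<^bsub>R\<^esub> n') \<odot>\<^bsub>M\<^esub> m \<oplus>\<^bsub>M\<^esub> (f [^]\<^bsub>R\<^esub> n) \<odot>\<^bsub>M\<^esub> m') (n + n')),
     smult = (\<lambda>r U. \<Union>(m, n)\<in>U. loc_frac R f M (r \<odot>\<^bsub>M\<^esub> m) n)\<rparr>"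

text \<open>
  The canonical map from the localization at \<open>f\<close> to the localization at \<open>h = f g\<close>:
  \<open>m / f\<^sup>n = g\<^sup>n m / h\<^sup>n\<close>.
\<close>

definition loc_res ::
  "('a, 'r) ring_scheme \<Rightarrow> 'a \<Rightarrow> 'a \<Rightarrow> ('a, 'c, 'm) module_scheme
    \<Rightarrow> ('c \<times> nat) set \<Rightarrow> ('c \<times> nat) set"
where
  "loc_res R g h M U = (\<Union>(m, n)\<in>U. loc_frac R h M ((g [^]\<^bsub>R\<^esub> n) \<odot>\<^bsub>M\<^esub> m) n)"

text \<open>
  Let \<open>h: M \<rightarrow> M'\<close> be additive with \<open>h(r m) = r\<^sup>q h(m)\<close>. It induces the additive map
  \<open>m / f\<^sup>n \<mapsto> h(m) / f\<^bsup>q n\<^esup>\<close> on localizations. The case \<open>q = 1\<close> is the usual localization of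
  a linear map; the case \<open>q = p\<close> is the localization of a linear map \<open>M \<rightarrow> F\<^sub>*M'\<close>, under the
  identification of the localization of \<open>F\<^sub>*M'\<close> with \<open>F\<^sub>*\<close> of the localization of \<open>M'\<close>.
\<close>

definition loc_map ::
  "('a, 'r) ring_scheme \<Rightarrow> 'a \<Rightarrow> ('a, 'd, 'm) module_scheme \<Rightarrow> nat \<Rightarrow> ('c \<Rightarrow> 'd)
    \<Rightarrow> ('c \<times> nat) set \<Rightarrow> ('d \<times> nat) set"
where
  "loc_map R f M' q h U = (\<Union>(m, n)\<in>U. loc_frac R f M' (h m) (q * n))"


section \<open>Local cohomology\<close>

text \<open>
  The Cech complex of \<open>M\<close> on the elements \<open>fs ! 0, \<dots>, fs ! (s - 1)\<close>, where \<open>s = length fs\<close>. In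
  degree \<open>i\<close> it is the direct sum of the localizations of \<open>M\<close> at \<open>cech_elem R fs I\<close>, over
  the index sets \<open>I\<close> of size \<open>i\<close>; its elements are families indexed by those sets.
\<close>

definition cech_index :: "'a list \<Rightarrow> nat \<Rightarrow> nat set set" where
  "cech_index fs i = {I. I \<subseteq> {..<length fs} \<and> card I = i}"

definition cech_elem :: "('a, 'r) ring_scheme \<Rightarrow> 'a list \<Rightarrow> nat set \<Rightarrow> 'a" where
  "cech_elem R fs I = (\<Otimes>\<^bsub>R\<^esub>j\<in>I. fs ! j)"

abbreviation cech_loc ::
  "('a, 'r) ring_scheme \<Rightarrow> 'a list \<Rightarrow> ('a, 'c, 'm) module_scheme \<Rightarrow> nat set
    \<Rightarrow> ('a, ('c \<times> nat) set) module"
where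
  "cech_loc R fs M I \<equiv> loc_module R (cech_elem R fs I) M"

definition cech_module ::
  "('a, 'r) ring_scheme \<Rightarrow> 'a list \<Rightarrow> ('a, 'c, 'm) module_scheme \<Rightarrow> nat
    \<Rightarrow> ('a, nat set \<Rightarrow> ('c \<times> nat) set) module"
where
  "cech_module R fs M i =
    \<lparr>carrier = (\<Pi>\<^sub>E I\<in>cech_index fs i. carrier (cech_loc R fs M I)),
     monoid.mult = undefined, one = undefined,
     ring.zero = (\<lambda>I\<in>cech_index fs i. \<zero>\<^bsub>cech_loc R fs M I\<^esub>),
     ring.add = (\<lambda>\<alpha> \<beta>. \<lambda>I\<in>cech_index fs i. \<alpha> I \<oplus>\<^bsub>cech_loc R fs M I\<^esub> \<beta> I),
     smult = (\<lambda>r \<alpha>. \<lambda>I\<in>cech_index fs i. r \<odot>\<^bsub>cech_loc R fs M I\<^esub> \<alpha> I)\<rparr>"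

definition cech_diff ::
  "('a, 'r) ring_scheme \<Rightarrow> 'a list \<Rightarrow> ('a, 'c, 'm) module_scheme \<Rightarrow> nat
    \<Rightarrow> (nat set \<Rightarrow> ('c \<times> nat) set) \<Rightarrow> (nat set \<Rightarrow> ('c \<times> nat) set)"
where
  "cech_diff R fs M i \<alpha> = (\<lambda>J\<in>cech_index fs (Suc i). \<Oplus>\<^bsub>cech_loc R fs M J\<^esub>j\<in>J.
     (let v = loc_res R (fs ! j) (cech_elem R fs J) M (\<alpha> (J - {j}))
      in if even (card {k \<in> J. k < j}) then v else \<ominus>\<^bsub>cech_loc R fs M J\<^esub> v))"

definition cech_cocycles ::
  "('a, 'r) ring_scheme \<Rightarrow> 'a list \<Rightarrow> ('a, 'c, 'm) module_scheme \<Rightarrow> nat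
    \<Rightarrow> (nat set \<Rightarrow> ('c \<times> nat) set) set"
where
  "cech_cocycles R fs M i =
    {\<alpha> \<in> carrier (cech_module R fs M i).
       cech_diff R fs M i \<alpha> = \<zero>\<^bsub>cech_module R fs M (Suc i)\<^esub>}"

definition cech_coboundaries ::
  "('a, 'r) ring_scheme \<Rightarrow> 'a list \<Rightarrow> ('a, 'c, 'm) module_scheme \<Rightarrow> nat
    \<Rightarrow> (nat set \<Rightarrow> ('c \<times> nat) set) set"
where
  "cech_coboundaries R fs M i = (case i of
      0 \<Rightarrow> {\<zero>\<^bsub>cech_module R fs M 0\<^esub>}
    | Suc j \<Rightarrow> cech_diff R fs M j ` carrier (cech_module R fs M j))"

text \<open>
  When the ideal generated by \<open>fs\<close> has radical \<open>I\<close>, this is the \<open>i\<close>-th local cohomology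
  module of \<open>M\<close> with support in \<open>I\<close>.
\<close>

definition local_cohomology ::
  "('a, 'r) ring_scheme \<Rightarrow> 'a list \<Rightarrow> ('a, 'c, 'm) module_scheme \<Rightarrow> nat
    \<Rightarrow> ('a, (nat set \<Rightarrow> ('c \<times> nat) set) set) module"
where
  "local_cohomology R fs M i =
    quot_module ((cech_module R fs M i)\<lparr>carrier := cech_cocycles R fs M i\<rparr>)
      (cech_coboundaries R fs M i)"

text \<open>The maps induced by \<open>h: M \<rightarrow> M'\<close> with \<open>h(r m) = r\<^sup>q h(m)\<close>, as for \<open>loc_map\<close>.\<close>

definition cech_map ::
  "('a, 'r) ring_scheme \<Rightarrow> 'a list \<Rightarrow> ('a, 'd, 'm) module_scheme \<Rightarrow> nat \<Rightarrow> nat \<Rightarrow> ('c \<Rightarrow> 'd)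
    \<Rightarrow> (nat set \<Rightarrow> ('c \<times> nat) set) \<Rightarrow> (nat set \<Rightarrow> ('d \<times> nat) set)"
where
  "cech_map R fs M' i q h \<alpha> =
    (\<lambda>I\<in>cech_index fs i. loc_map R (cech_elem R fs I) M' q h (\<alpha> I))"

definition local_cohomology_map ::
  "('a, 'r) ring_scheme \<Rightarrow> 'a list \<Rightarrow> ('a, 'd, 'm) module_scheme \<Rightarrow> nat \<Rightarrow> nat \<Rightarrow> ('c \<Rightarrow> 'd)
    \<Rightarrow> (nat set \<Rightarrow> ('c \<times> nat) set) set \<Rightarrow> (nat set \<Rightarrow> ('d \<times> nat) set) set"
where
  "local_cohomology_map R fs M' i q h =
    induced_map (cech_module R fs M' i) (cech_coboundaries R fs M' i) (cech_map R fs M' i q h)"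


section \<open>Frobenius actions\<close>

text \<open>The Frobenius action on the local cohomology of an \<open>R\<close>-algebra \<open>A\<close> of characteristic \<open>p\<close>.\<close>

definition natural_frobenius ::
  "('a, 'r) ring_scheme \<Rightarrow> 'a list \<Rightarrow> nat \<Rightarrow> ('a, 'c, 'm) module_scheme \<Rightarrow> nat
    \<Rightarrow> (nat set \<Rightarrow> ('c \<times> nat) set) set \<Rightarrow> (nat set \<Rightarrow> ('c \<times> nat) set) set"
where
  "natural_frobenius R fs p A i = local_cohomology_map R fs A i p (\<lambda>a. a [^]\<^bsub>A\<^esub> p)"

definition F_compatible ::
  "('a, 'r) ring_scheme \<Rightarrow> ('a, 'c, 'm) module_scheme \<Rightarrow> ('c \<Rightarrow> 'c) \<Rightarrow> 'c set \<Rightarrow> bool" where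
  "F_compatible R M \<rho> N \<longleftrightarrow> submodule N R M \<and> \<rho> ` N \<subseteq> N"

definition anti_nilpotent ::
  "('a, 'r) ring_scheme \<Rightarrow> ('a, 'c, 'm) module_scheme \<Rightarrow> ('c \<Rightarrow> 'c) \<Rightarrow> bool" where
  "anti_nilpotent R M \<rho> \<longleftrightarrow> (\<forall>N. F_compatible R M \<rho> N \<longrightarrow>
     inj_on (induced_map M N \<rho>) (carrier (quot_module M N)))"


section \<open>Surjective elements\<close>

definition surjective_element ::
  "('a, 'r) ring_scheme \<Rightarrow> 'a set \<Rightarrow> 'a list \<Rightarrow> 'a \<Rightarrow> bool" where
  "surjective_element R m fs x \<longleftrightarrow> x \<in> m \<and> regular_element R x \<and>
     (\<forall>l::nat. \<forall>i::nat. l > 0 \<longrightarrow>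
       local_cohomology_map R fs (quot_algebra R (PIdl\<^bsub>R\<^esub> x)) i 1 (quot_proj R (PIdl\<^bsub>R\<^esub> x)) `
         carrier (local_cohomology R fs (quot_algebra R (PIdl\<^bsub>R\<^esub> (x [^]\<^bsub>R\<^esub> l))) i)
       = carrier (local_cohomology R fs (quot_algebra R (PIdl\<^bsub>R\<^esub> x)) i))"

end

theory Submission
  imports Defs
begin

text \<open>
  Let \<open>N\<^sub>l\<close> be the image of \<open>H\<^sup>i(R/x\<^sup>l) \<rightarrow> H\<^sup>i(R/x)\<close>. Raising to the \<open>p\<close>-th power gives a map
  \<open>R/x\<^sup>l \<rightarrow> R/x\<^sup>k\<close> for every \<open>k \<le> p l\<close>, in particular for \<open>k = l + 1\<close>, and it lifts the Frobenius
  map of \<open>R/x\<close>. So the Frobenius action sends \<open>N\<^sub>l\<close> into \<open>N\<^bsub>l+1\<^esub>\<close>. If \<open>N\<^sub>l = H\<^sup>i(R/x)\<close>, then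
  \<open>N\<^bsub>l+1\<^esub>\<close> is F-compatible and the induced action on \<open>H\<^sup>i(R/x) / N\<^bsub>l+1\<^esub>\<close> is zero; it is also
  injective, hence \<open>N\<^bsub>l+1\<^esub> = H\<^sup>i(R/x)\<close>. As \<open>N\<^sub>1 = H\<^sup>i(R/x)\<close>, induction on \<open>l\<close> concludes.
\<close>

section \<open>Localization at an element\<close>

text \<open>The map on cohomology that carries the argument, induced by a -> a^p from R/x^l to
  R/x^(l+1), is not R-linear, so functoriality for linear maps does not produce it. Functoriality of
  the Cech complex is therefore proved for additive maps h with h(r m) = r^q h(m): q = 1 covers the
  projections and multiplication by a scalar, q = p the Frobenius map and its lifts. Such maps
  compose, exponents multiplying, and identities between them pass to cohomology. The only one with
  content is a square: projecting R/x^l to R/x and then taking p-th powers agrees with lifting to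
  R/x^(l+1) and then projecting, since both send the coset of a to the coset of a^p. A single
  inclusion drives the induction step: if every class comes from R/x^l, then the Frobenius action
  maps all of the cohomology of R/x into the image from R/x^(l+1). Compatibility of that image and
  vanishing of the action on the quotient both follow from it. Anti-nilpotency speaks of submodules,
  so closure of the image under scalars must be shown too; it is again functoriality, applied to
  multiplication by r.\<close>

lemma additive_imp_abelian_group_hom:
  assumes "abelian_group G" "abelian_group H"
    and "\<And>a b. \<lbrakk>a \<in> carrier G; b \<in> carrier G\<rbrakk> \<Longrightarrow> h a \<in> carrier H"
    and "\<And>a b. \<lbrakk>a \<in> carrier G; b \<in> carrier G\<rbrakk> \<Longrightarrow> h (a \<oplus>\<^bsub>G\<^esub> b) = h a \<oplus>\<^bsub>H\<^esub> h b"
  shows "abelian_group_hom G H h"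
proof (intro abelian_group_homI assms(1,2) group_hom.intro group_hom_axioms.intro)
  show "group (add_monoid G)" "group (add_monoid H)"
    using assms(1,2) by (simp_all add: abelian_group.a_group)
qed (use assms(3,4) in \<open>auto simp: hom_def\<close>)

locale module_localization = module R M for R (structure) and M (structure) +
  fixes f assumes f_closed [simp]: "f \<in> carrier R"
begin

abbreviation frac where "frac \<equiv> loc_frac R f M"

abbreviation L where "L \<equiv> loc_module R f M"

lemma pow_smult:
  "m \<in> carrier M \<Longrightarrow> f [^] (j + k :: nat) \<odot>\<^bsub>M\<^esub> m = f [^] j \<odot>\<^bsub>M\<^esub> (f [^] k \<odot>\<^bsub>M\<^esub> m)"
  using nat_pow_mult[of f j k] smult_assoc1[of "f [^] j" "f [^] k" m] by simp

lemma smult_lcomm: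
  "\<lbrakk>a \<in> carrier R; b \<in> carrier R; m \<in> carrier M\<rbrakk>
    \<Longrightarrow> a \<odot>\<^bsub>M\<^esub> (b \<odot>\<^bsub>M\<^esub> m) = b \<odot>\<^bsub>M\<^esub> (a \<odot>\<^bsub>M\<^esub> m)"
  using m_comm[of a b] smult_assoc1[of a b m] smult_assoc1[of b a m] by simp

lemma loc_rel_refl: "m \<in> carrier M \<Longrightarrow> ((m, n), (m, n)) \<in> loc_rel R f M"
  by (simp add: loc_rel_def)

lemma loc_rel_sym: "((m, n), (m', n')) \<in> loc_rel R f M \<Longrightarrow> ((m', n'), (m, n)) \<in> loc_rel R f M"
  unfolding loc_rel_def mem_Collect_eq prod.case by (elim conjE exE, intro conjI exI, assumption+, erule sym)

text \<open>Scale the first equation by f^(k+c) and the second by f^(j+a). The denominator exponent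
  b of the middle fraction is absorbed into the new witness j + k + b.\<close>

lemma loc_rel_trans:
  assumes "((m, a), (m', b)) \<in> loc_rel R f M" "((m', b), (m'', c)) \<in> loc_rel R f M"
  shows "((m, a), (m'', c)) \<in> loc_rel R f M"
proof -
  from assms obtain j k
    where mem: "m \<in> carrier M" "m' \<in> carrier M" "m'' \<in> carrier M"
      and j: "f [^] (j + b) \<odot>\<^bsub>M\<^esub> m = f [^] (j + a) \<odot>\<^bsub>M\<^esub> m'"
      and k: "f [^] (k + c) \<odot>\<^bsub>M\<^esub> m' = f [^] (k + b) \<odot>\<^bsub>M\<^esub> m''"
    unfolding loc_rel_def by auto
  have "f [^] (j + k + b + c) \<odot>\<^bsub>M\<^esub> m = f [^] (k + c) \<odot>\<^bsub>M\<^esub> (f [^] (j + b) \<odot>\<^bsub>M\<^esub> m)"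
    by (simp add: mem add.commute add.left_commute flip: pow_smult)
  also have "\<dots> = f [^] (j + a) \<odot>\<^bsub>M\<^esub> (f [^] (k + c) \<odot>\<^bsub>M\<^esub> m')"
    unfolding j by (rule smult_lcomm) (simp_all add: mem)
  also have "\<dots> = f [^] (j + k + b + a) \<odot>\<^bsub>M\<^esub> m''"
    unfolding k by (simp add: mem add.commute add.left_commute flip: pow_smult)
  finally show ?thesis
    using mem unfolding loc_rel_def by (auto intro!: exI[of _ "j + k + b"])
qed

lemma frac_eq_iff:
  assumes "m \<in> carrier M" "m' \<in> carrier M"
  shows "frac m n = frac m' n' \<longleftrightarrow>
    (\<exists>k::nat. f [^] (k + n') \<odot>\<^bsub>M\<^esub> m = f [^] (k + n) \<odot>\<^bsub>M\<^esub> m')"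
proof -
  have "frac m n = frac m' n' \<longleftrightarrow> ((m, n), (m', n')) \<in> loc_rel R f M"
  proof
    assume "frac m n = frac m' n'"
    then show "((m, n), (m', n')) \<in> loc_rel R f M"
      using loc_rel_refl[OF assms(2), of n'] by (auto simp: loc_frac_def)
  next
    assume *: "((m, n), (m', n')) \<in> loc_rel R f M"
    show "frac m n = frac m' n'"
      unfolding loc_frac_def
      using loc_rel_trans[OF *] loc_rel_trans[OF loc_rel_sym[OF *]] by auto
  qed
  then show ?thesis
    using assms by (simp add: loc_rel_def)
qed

lemma frac_eqI:
  assumes "m \<in> carrier M" "m' \<in> carrier M" "f [^] (k + n') \<odot>\<^bsub>M\<^esub> m = f [^] (k + n) \<odot>\<^bsub>M\<^esub> m'"
  shows "frac m n = frac m' n'"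
  using assms frac_eq_iff by blast

lemma frac_eqE:
  assumes "frac m n = frac m' n'" "m \<in> carrier M" "m' \<in> carrier M"
  obtains k :: nat where "f [^] (k + n') \<odot>\<^bsub>M\<^esub> m = f [^] (k + n) \<odot>\<^bsub>M\<^esub> m'"
  using assms frac_eq_iff by blast

lemma mem_frac_iff:
  assumes "m \<in> carrier M"
  shows "(m', n') \<in> frac m n \<longleftrightarrow> m' \<in> carrier M \<and> frac m' n' = frac m n"
proof -
  have "(m', n') \<in> frac m n \<longleftrightarrow> m' \<in> carrier M \<and>
      (\<exists>k::nat. f [^] (k + n') \<odot>\<^bsub>M\<^esub> m = f [^] (k + n) \<odot>\<^bsub>M\<^esub> m')"
    by (simp only: loc_frac_def loc_rel_def Image_singleton_iff mem_Collect_eq prod.case assms simp_thms)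
  also have "\<dots> \<longleftrightarrow> m' \<in> carrier M \<and> frac m' n' = frac m n"
    using frac_eq_iff[OF assms, of m' n n'] by (simp only: eq_commute[of "frac m' n'"] cong: conj_cong)
  finally show ?thesis .
qed

lemma frac_self: "m \<in> carrier M \<Longrightarrow> (m, n) \<in> frac m n"
  by (simp add: mem_frac_iff)

text \<open>The operations on fractions are unions over all representatives of a class. Once all
  representatives give the same value, the union is over a nonempty set and collapses to it, so each
  later formula on fractions reduces to a well-definedness check.\<close>

lemma UN_frac:
  assumes "m \<in> carrier M"
    and "\<And>m' n'. \<lbrakk>m' \<in> carrier M; frac m' n' = frac m n\<rbrakk> \<Longrightarrow> g m' n' = g m n"
  shows "(\<Union>(m', n')\<in>frac m n. g m' n') = g m n"
proof -
  have "(\<lambda>(m', n'). g m' n') u = g m n" if "u \<in> frac m n" for u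
  proof (cases u)
    case (Pair m' n')
    with that show ?thesis
      by (simp only: prod.case) (rule assms(2); simp add: mem_frac_iff[OF assms(1)])
  qed
  then have "(\<Union>u\<in>frac m n. (\<lambda>(m', n'). g m' n') u) = (\<Union>u\<in>frac m n. g m n)"
    by (rule SUP_cong[OF refl])
  also have "\<dots> = g m n"
    using frac_self[OF assms(1), of n] by blast
  finally show ?thesis .
qed

section \<open>The group of fractions\<close>

lemma carrier_loc_module: "carrier L = {frac m n |m n. m \<in> carrier M}"
  by (auto simp: loc_module_def quotient_def loc_frac_def)

lemma frac_closed [simp]: "m \<in> carrier M \<Longrightarrow> frac m n \<in> carrier L"
  by (auto simp: carrier_loc_module)

lemma loc_cases:
  assumes "u \<in> carrier L"
  obtains m n where "m \<in> carrier M" "u = frac m n"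
  using assms by (auto simp: carrier_loc_module)

lemma loc_zero: "\<zero>\<^bsub>L\<^esub> = frac \<zero>\<^bsub>M\<^esub> 0"
  by (simp add: loc_module_def)

lemma frac_zero: "frac \<zero>\<^bsub>M\<^esub> n = frac \<zero>\<^bsub>M\<^esub> 0"
  by (rule frac_eqI[where k = 0]) simp_all

text \<open>Collects the exponent arithmetic in one place: multiply the given equation by f^e and
  split the total exponents e + a and e + b in whatever way the goal writes them.\<close>

lemma pow_smult_scale:
  assumes "u \<in> carrier M" "v \<in> carrier M"
    and eq: "f [^] (a :: nat) \<odot>\<^bsub>M\<^esub> u = f [^] (b :: nat) \<odot>\<^bsub>M\<^esub> v"
    and "i + j = e + a" "i' + j' = e + b"
  shows "f [^] i \<odot>\<^bsub>M\<^esub> (f [^] j \<odot>\<^bsub>M\<^esub> u) = f [^] i' \<odot>\<^bsub>M\<^esub> (f [^] j' \<odot>\<^bsub>M\<^esub> v)"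
proof -
  have "f [^] i \<odot>\<^bsub>M\<^esub> (f [^] j \<odot>\<^bsub>M\<^esub> u) = f [^] e \<odot>\<^bsub>M\<^esub> (f [^] a \<odot>\<^bsub>M\<^esub> u)"
    by (simp only: assms(1,4) flip: pow_smult)
  also have "\<dots> = f [^] i' \<odot>\<^bsub>M\<^esub> (f [^] j' \<odot>\<^bsub>M\<^esub> v)"
    unfolding eq by (simp only: assms(2,5) flip: pow_smult)
  finally show ?thesis .
qed

lemma frac_add_wd:
  assumes mem: "u \<in> carrier M" "v \<in> carrier M" "u' \<in> carrier M" "v' \<in> carrier M"
    and eq: "frac u b = frac v c" "frac u' b' = frac v' c'"
  shows "frac (f [^] b' \<odot>\<^bsub>M\<^esub> u \<oplus>\<^bsub>M\<^esub> f [^] b \<odot>\<^bsub>M\<^esub> u') (b + b')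
      = frac (f [^] c' \<odot>\<^bsub>M\<^esub> v \<oplus>\<^bsub>M\<^esub> f [^] c \<odot>\<^bsub>M\<^esub> v') (c + c')"
proof -
  obtain k where k: "f [^] (k + c) \<odot>\<^bsub>M\<^esub> u = f [^] (k + b) \<odot>\<^bsub>M\<^esub> v"
    using eq(1) mem(1,2) by (rule frac_eqE)
  obtain k' where k': "f [^] (k' + c') \<odot>\<^bsub>M\<^esub> u' = f [^] (k' + b') \<odot>\<^bsub>M\<^esub> v'"
    using eq(2) mem(3,4) by (rule frac_eqE)
  \<comment> \<open>Both summands have to be compared after multiplication by one common power, so
    the two witnesses are added. In each line \<open>e\<close> is the surplus over the exponent of
    the equation that is used there.\<close>
  have 1: "f [^] (k + k' + (c + c')) \<odot>\<^bsub>M\<^esub> (f [^] b' \<odot>\<^bsub>M\<^esub> u)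
      = f [^] (k + k' + (b + b')) \<odot>\<^bsub>M\<^esub> (f [^] c' \<odot>\<^bsub>M\<^esub> v)"
    by (rule pow_smult_scale[OF mem(1,2) k, where e = "k' + c' + b'"]) simp_all
  have 2: "f [^] (k + k' + (c + c')) \<odot>\<^bsub>M\<^esub> (f [^] b \<odot>\<^bsub>M\<^esub> u')
      = f [^] (k + k' + (b + b')) \<odot>\<^bsub>M\<^esub> (f [^] c \<odot>\<^bsub>M\<^esub> v')"
    by (rule pow_smult_scale[OF mem(3,4) k', where e = "k + c + b"]) simp_all
  show ?thesis
    by (rule frac_eqI[where k = "k + k'"]) (simp_all only: smult_r_distr mem 1 2 smult_closed nat_pow_closed f_closed M.a_closed)
qed

lemma frac_add:
  assumes m: "m \<in> carrier M" and m': "m' \<in> carrier M"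
  shows "frac m n \<oplus>\<^bsub>L\<^esub> frac m' n' = frac (f [^] n' \<odot>\<^bsub>M\<^esub> m \<oplus>\<^bsub>M\<^esub> f [^] n \<odot>\<^bsub>M\<^esub> m') (n + n')"
proof -
  have inner: "(\<Union>(v, c)\<in>frac m' n'. frac (f [^] c \<odot>\<^bsub>M\<^esub> u \<oplus>\<^bsub>M\<^esub> f [^] b \<odot>\<^bsub>M\<^esub> v) (b + c))
      = frac (f [^] n' \<odot>\<^bsub>M\<^esub> u \<oplus>\<^bsub>M\<^esub> f [^] b \<odot>\<^bsub>M\<^esub> m') (b + n')" if u: "u \<in> carrier M" for u b
    by (rule UN_frac[OF m']) (rule frac_add_wd[OF u u _ m' refl])
  have "frac m n \<oplus>\<^bsub>L\<^esub> frac m' n' = (\<Union>(u, b)\<in>frac m n.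
      \<Union>(v, c)\<in>frac m' n'. frac (f [^] c \<odot>\<^bsub>M\<^esub> u \<oplus>\<^bsub>M\<^esub> f [^] b \<odot>\<^bsub>M\<^esub> v) (b + c))"
    by (simp add: loc_module_def)
  also have "\<dots> = (\<Union>(v, c)\<in>frac m' n'. frac (f [^] c \<odot>\<^bsub>M\<^esub> m \<oplus>\<^bsub>M\<^esub> f [^] n \<odot>\<^bsub>M\<^esub> v) (n + c))"
    by (rule UN_frac[OF m]) (simp only: inner m, rule frac_add_wd[OF _ m m' m' _ refl])
  also have "\<dots> = frac (f [^] n' \<odot>\<^bsub>M\<^esub> m \<oplus>\<^bsub>M\<^esub> f [^] n \<odot>\<^bsub>M\<^esub> m') (n + n')"
    by (rule inner[OF m])
  finally show ?thesis .
qed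

lemma frac_add_same:
  assumes "m \<in> carrier M" "m' \<in> carrier M"
  shows "frac m n \<oplus>\<^bsub>L\<^esub> frac m' n = frac (m \<oplus>\<^bsub>M\<^esub> m') n"
  unfolding frac_add[OF assms]
  by (rule frac_eqI[where k = 0])
     (use assms in \<open>simp_all add: smult_r_distr pow_smult\<close>)

text \<open>Lets additivity of maps be checked with \<open>frac_add_same\<close>, where the sum of
  two fractions is the sum of the numerators and no power of f appears.\<close>

lemma frac_common_denom:
  assumes "u \<in> carrier L" "v \<in> carrier L"
  obtains m m' n where "m \<in> carrier M" "m' \<in> carrier M" "u = frac m n" "v = frac m' n"
proof -
  obtain m a m' b where mem: "m \<in> carrier M" "m' \<in> carrier M" "u = frac m a" "v = frac m' b"
    using assms loc_cases by metis
  have "u = frac (f [^] b \<odot>\<^bsub>M\<^esub> m) (a + b)" "v = frac (f [^] a \<odot>\<^bsub>M\<^esub> m') (a + b)"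
    unfolding mem(3,4) by (rule frac_eqI[where k = 0]; use mem in \<open>simp add: pow_smult smult_lcomm\<close>)+
  with mem show thesis
    using that[of "f [^] b \<odot>\<^bsub>M\<^esub> m" "f [^] a \<odot>\<^bsub>M\<^esub> m'" "a + b"] by simp
qed

lemma abelian_group_loc_module: "abelian_group L"
proof (rule abelian_groupI)
  fix u v assume uv: "u \<in> carrier L" "v \<in> carrier L"
  then obtain m m' n where *: "m \<in> carrier M" "m' \<in> carrier M" "u = frac m n" "v = frac m' n"
    by (rule frac_common_denom)
  then show "u \<oplus>\<^bsub>L\<^esub> v \<in> carrier L" "u \<oplus>\<^bsub>L\<^esub> v = v \<oplus>\<^bsub>L\<^esub> u"
    by (simp_all add: frac_add_same M.add.m_comm)
next
  fix u v w assume "u \<in> carrier L" "v \<in> carrier L" "w \<in> carrier L"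
  then obtain a b c m n k where
    mem: "a \<in> carrier M" "b \<in> carrier M" "c \<in> carrier M" "u = frac a m" "v = frac b n" "w = frac c k"
    by (metis loc_cases)
  show "u \<oplus>\<^bsub>L\<^esub> v \<oplus>\<^bsub>L\<^esub> w = u \<oplus>\<^bsub>L\<^esub> (v \<oplus>\<^bsub>L\<^esub> w)"
    using mem
    by (simp add: frac_add smult_r_distr M.add.m_assoc pow_smult smult_lcomm ac_simps)
next
  fix u assume "u \<in> carrier L"
  then obtain m n where *: "m \<in> carrier M" "u = frac m n"
    by (rule loc_cases)
  then show "\<zero>\<^bsub>L\<^esub> \<oplus>\<^bsub>L\<^esub> u = u"
    by (simp add: loc_zero frac_add)
  have "frac (\<ominus>\<^bsub>M\<^esub> m) n \<oplus>\<^bsub>L\<^esub> u = \<zero>\<^bsub>L\<^esub>"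
    using * by (simp add: loc_zero frac_add_same frac_zero[of n] M.l_neg)
  with * show "\<exists>v\<in>carrier L. v \<oplus>\<^bsub>L\<^esub> u = \<zero>\<^bsub>L\<^esub>"
    using M.a_inv_closed frac_closed by blast
qed (simp add: loc_zero)

lemma frac_smult:
  assumes r: "r \<in> carrier R" and m: "m \<in> carrier M"
  shows "r \<odot>\<^bsub>L\<^esub> frac m n = frac (r \<odot>\<^bsub>M\<^esub> m) n"
proof -
  have "frac (r \<odot>\<^bsub>M\<^esub> m') n' = frac (r \<odot>\<^bsub>M\<^esub> m) n"
    if m': "m' \<in> carrier M" "frac m' n' = frac m n" for m' n'
  proof -
    obtain k where k: "f [^] (k + n) \<odot>\<^bsub>M\<^esub> m' = f [^] (k + n') \<odot>\<^bsub>M\<^esub> m"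
      using m'(2,1) m by (rule frac_eqE)
    show ?thesis
      by (rule frac_eqI[where k = k]) (use k r m m' in \<open>simp_all add: smult_lcomm[of _ r]\<close>)
  qed
  then show ?thesis
    unfolding loc_module_def by (simp add: UN_frac[OF m])
qed

section \<open>Restriction to a further localization\<close>

lemma loc_res_frac:
  assumes g: "g \<in> carrier R" and m: "m \<in> carrier M"
  shows "loc_res R g (f \<otimes> g) M (frac m n) = loc_frac R (f \<otimes> g) M (g [^] n \<odot>\<^bsub>M\<^esub> m) n"
  unfolding loc_res_def
proof (rule UN_frac[OF m])
  interpret fg: module_localization R M "f \<otimes> g"
    by unfold_locales (simp add: g)
  fix m' n' assume m': "m' \<in> carrier M" "frac m' n' = frac m n"
  obtain k where k: "f [^] (k + n) \<odot>\<^bsub>M\<^esub> m' = f [^] (k + n') \<odot>\<^bsub>M\<^esub> m"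
    using m'(2,1) m by (rule frac_eqE)
  \<comment> \<open>The exponent of g depends on a and b only through a + b. Hence the choices (n,
    n') and (n', n) produce the same power of g, and what is left is the equation
    \<open>k\<close>.\<close>
  have *: "(f \<otimes> g) [^] (k + a) \<odot>\<^bsub>M\<^esub> (g [^] b \<odot>\<^bsub>M\<^esub> u)
      = g [^] (k + a + b) \<odot>\<^bsub>M\<^esub> (f [^] (k + a) \<odot>\<^bsub>M\<^esub> u)" if u: "u \<in> carrier M" for u and a b :: nat
  proof -
    have "(f \<otimes> g) [^] (k + a) \<odot>\<^bsub>M\<^esub> (g [^] b \<odot>\<^bsub>M\<^esub> u)
        = f [^] (k + a) \<odot>\<^bsub>M\<^esub> (g [^] (k + a) \<odot>\<^bsub>M\<^esub> (g [^] b \<odot>\<^bsub>M\<^esub> u))"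
      using u g nat_pow_distrib[of f g "k + a"] by (simp add: smult_assoc1)
    also have "\<dots> = f [^] (k + a) \<odot>\<^bsub>M\<^esub> (g [^] (k + a + b) \<odot>\<^bsub>M\<^esub> u)"
      using u g nat_pow_mult[of g "k + a" b] smult_assoc1[of "g [^] (k + a)" "g [^] b" u] by simp
    finally show ?thesis
      using u g by (simp add: smult_lcomm)
  qed
  show "loc_frac R (f \<otimes> g) M (g [^] n' \<odot>\<^bsub>M\<^esub> m') n' = loc_frac R (f \<otimes> g) M (g [^] n \<odot>\<^bsub>M\<^esub> m) n"
    by (rule fg.frac_eqI[where k = k])
       (use g m m' in \<open>simp_all add: * k add.commute add.left_commute\<close>)
qed

lemma loc_res_hom:
  assumes g: "g \<in> carrier R"
  shows "abelian_group_hom L (loc_module R (f \<otimes> g) M) (loc_res R g (f \<otimes> g) M)"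
proof -
  interpret fg: module_localization R M "f \<otimes> g"
    by unfold_locales (simp add: g)
  show ?thesis
  proof (rule additive_imp_abelian_group_hom[OF abelian_group_loc_module fg.abelian_group_loc_module])
    fix u v assume "u \<in> carrier L" "v \<in> carrier L"
    then obtain m m' n where *: "m \<in> carrier M" "m' \<in> carrier M" "u = frac m n" "v = frac m' n"
      by (rule frac_common_denom)
    then show "loc_res R g (f \<otimes> g) M u \<in> carrier fg.L"
      and "loc_res R g (f \<otimes> g) M (u \<oplus>\<^bsub>L\<^esub> v) = loc_res R g (f \<otimes> g) M u \<oplus>\<^bsub>fg.L\<^esub> loc_res R g (f \<otimes> g) M v"
      using g by (simp_all add: loc_res_frac frac_add_same fg.frac_add_same smult_r_distr)
  qed
qed

end

lemma (in abelian_group_hom) hom_finsum: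
  assumes "g \<in> A \<rightarrow> carrier G"
  shows "h (finsum G g A) = finsum H (\<lambda>a. h (g a)) A"
  using assms
proof (induction A rule: infinite_finite_induct)
  case (insert a A)
  then have "(\<lambda>a. h (g a)) \<in> A \<rightarrow> carrier H" "g \<in> A \<rightarrow> carrier G"
    by (auto simp: Pi_iff)
  with insert show ?case
    by (simp add: G.finsum_insert H.finsum_insert)
qed simp_all

section \<open>Semilinear maps and their localizations\<close>

text \<open>The exponent is a parameter so that R-linear maps and linear maps into the Frobenius
  twist of N are one notion, with a single proof of functoriality for both.\<close>

locale semilinear_map = M: module R M + N: module R N
  for R (structure) and M (structure) and N (structure) +
  fixes q :: nat and h
  assumes h_closed [simp]: "m \<in> carrier M \<Longrightarrow> h m \<in> carrier N"
    and h_add: "\<lbrakk>m \<in> carrier M; m' \<in> carrier M\<rbrakk> \<Longrightarrow> h (m \<oplus>\<^bsub>M\<^esub> m') = h m \<oplus>\<^bsub>N\<^esub> h m'"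
    and h_smult: "\<lbrakk>r \<in> carrier R; m \<in> carrier M\<rbrakk> \<Longrightarrow> h (r \<odot>\<^bsub>M\<^esub> m) = (r [^] q) \<odot>\<^bsub>N\<^esub> h m"
begin

lemma h_pow_smult:
  assumes "f \<in> carrier R" "m \<in> carrier M"
  shows "h (f [^] (n::nat) \<odot>\<^bsub>M\<^esub> m) = f [^] (q * n) \<odot>\<^bsub>N\<^esub> h m"
  using assms by (simp add: h_smult M.R.nat_pow_pow mult.commute)

lemma loc_map_frac:
  assumes f: "f \<in> carrier R" and m: "m \<in> carrier M"
  shows "loc_map R f N q h (loc_frac R f M m n) = loc_frac R f N (h m) (q * n)"
proof -
  interpret LM: module_localization R M f by unfold_locales (rule f)
  interpret LN: module_localization R N f by unfold_locales (rule f)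
  show ?thesis
    unfolding loc_map_def
  proof (rule LM.UN_frac[OF m])
    fix m' n' assume m': "m' \<in> carrier M" "LM.frac m' n' = LM.frac m n"
    obtain k where k: "f [^] (k + n) \<odot>\<^bsub>M\<^esub> m' = f [^] (k + n') \<odot>\<^bsub>M\<^esub> m"
      using m'(2,1) m by (rule LM.frac_eqE)
    \<comment> \<open>Applying h to the equation \<open>k\<close> multiplies every exponent of f by
      q, the witness included.\<close>
    have "f [^] (q * k + q * n) \<odot>\<^bsub>N\<^esub> h m' = f [^] (q * k + q * n') \<odot>\<^bsub>N\<^esub> h m"
      using arg_cong[OF k, of h] h_pow_smult[OF f m'(1), of "k + n"] h_pow_smult[OF f m, of "k + n'"]
      by (simp only: distrib_left)
    then show "LN.frac (h m') (q * n') = LN.frac (h m) (q * n)"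
      by (intro LN.frac_eqI[where k = "q * k"] h_closed m m')
  qed
qed

lemma loc_map_hom:
  assumes f: "f \<in> carrier R"
  shows "abelian_group_hom (loc_module R f M) (loc_module R f N) (loc_map R f N q h)"
proof -
  interpret LM: module_localization R M f by unfold_locales (rule f)
  interpret LN: module_localization R N f by unfold_locales (rule f)
  show ?thesis
  proof (rule additive_imp_abelian_group_hom[OF LM.abelian_group_loc_module LN.abelian_group_loc_module])
    fix u v assume "u \<in> carrier LM.L" "v \<in> carrier LM.L"
    then obtain m m' n where *: "m \<in> carrier M" "m' \<in> carrier M" "u = LM.frac m n" "v = LM.frac m' n"
      by (rule LM.frac_common_denom)
    then show "loc_map R f N q h u \<in> carrier LN.L"
      and "loc_map R f N q h (u \<oplus>\<^bsub>LM.L\<^esub> v) = loc_map R f N q h u \<oplus>\<^bsub>LN.L\<^esub> loc_map R f N q h v"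
      using f by (simp_all add: loc_map_frac LM.frac_add_same LN.frac_add_same h_add)
  qed
qed

text \<open>h turns the factor g^n into g^(q n), and q n is also the denominator exponent after
  \<open>loc_map\<close>, hence the power of g by which restriction multiplies there.\<close>

lemma loc_map_res:
  assumes f: "f \<in> carrier R" and g: "g \<in> carrier R" and u: "u \<in> carrier (loc_module R f M)"
  shows "loc_map R (f \<otimes> g) N q h (loc_res R g (f \<otimes> g) M u)
    = loc_res R g (f \<otimes> g) N (loc_map R f N q h u)"
proof -
  interpret LM: module_localization R M f by unfold_locales (rule f)
  interpret LN: module_localization R N f by unfold_locales (rule f)
  obtain m n where "m \<in> carrier M" "u = LM.frac m n"
    using u by (rule LM.loc_cases)
  with f g show ?thesis
    by (simp add: LM.loc_res_frac LN.loc_res_frac loc_map_frac h_pow_smult)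
qed

end

text \<open>Commutativity of R makes multiplication by r a linear map. This brings the scalar action
  on local cohomology under functoriality.\<close>

lemma (in module) semilinear_map_smult:
  "r \<in> carrier R \<Longrightarrow> semilinear_map R M M 1 (\<lambda>m. r \<odot>\<^bsub>M\<^esub> m)"
  by (unfold_locales)
     (auto simp: smult_r_distr m_comm R.nat_pow_eone simp flip: smult_assoc1)

lemma semilinear_map_comp:
  assumes "semilinear_map R M N q h" "semilinear_map R N P q' h'"
  shows "semilinear_map R M P (q' * q) (\<lambda>m. h' (h m))"
proof -
  interpret h: semilinear_map R M N q h by fact
  interpret h': semilinear_map R N P q' h' by fact
  show ?thesis
    by unfold_locales
       (simp_all add: h.h_add h'.h_add h.h_smult h'.h_smult h.M.R.nat_pow_pow mult.commute)
qed

lemma semilinear_map_cong: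
  assumes "semilinear_map R M N q h" and eq: "\<And>m. m \<in> carrier M \<Longrightarrow> h' m = h m"
  shows "semilinear_map R M N q h'"
proof -
  interpret semilinear_map R M N q h by fact
  show ?thesis
    by unfold_locales (simp_all add: eq h_add h_smult)
qed

lemma (in module_localization) loc_map_smult:
  assumes "r \<in> carrier R" "u \<in> carrier L"
  shows "loc_map R f M 1 (\<lambda>m. r \<odot>\<^bsub>M\<^esub> m) u = r \<odot>\<^bsub>L\<^esub> u"
proof -
  interpret r: semilinear_map R M M 1 "\<lambda>m. r \<odot>\<^bsub>M\<^esub> m"
    using assms(1) by (rule semilinear_map_smult)
  obtain m n where "m \<in> carrier M" "u = frac m n"
    using assms(2) by (rule loc_cases)
  then show ?thesis
    using r.loc_map_frac[OF f_closed, of m n] assms(1) by (simp add: frac_smult)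
qed

lemma loc_map_comp:
  assumes h: "semilinear_map R M N q h" and h': "semilinear_map R N P q' h'"
    and f: "f \<in> carrier R" and u: "u \<in> carrier (loc_module R f M)"
  shows "loc_map R f P q' h' (loc_map R f N q h u) = loc_map R f P (q' * q) (\<lambda>m. h' (h m)) u"
proof -
  interpret h: semilinear_map R M N q h by fact
  interpret h': semilinear_map R N P q' h' by fact
  interpret c: semilinear_map R M P "q' * q" "\<lambda>m. h' (h m)"
    using h h' by (rule semilinear_map_comp)
  interpret LM: module_localization R M f by unfold_locales (rule f)
  obtain m n where "m \<in> carrier M" "u = LM.frac m n"
    using u by (rule LM.loc_cases)
  with f show ?thesis
    by (simp add: h.loc_map_frac h'.loc_map_frac c.loc_map_frac mult.assoc)
qed

lemma loc_map_cong:
  assumes h: "semilinear_map R M N q h" and h': "semilinear_map R M N q h'"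
    and eq: "\<And>m. m \<in> carrier M \<Longrightarrow> h m = h' m"
    and f: "f \<in> carrier R" and u: "u \<in> carrier (loc_module R f M)"
  shows "loc_map R f N q h u = loc_map R f N q h' u"
proof -
  interpret h: semilinear_map R M N q h by fact
  interpret h': semilinear_map R M N q h' by fact
  interpret LM: module_localization R M f by unfold_locales (rule f)
  obtain m n where "m \<in> carrier M" "u = LM.frac m n"
    using u by (rule LM.loc_cases)
  with f show ?thesis
    by (simp add: h.loc_map_frac h'.loc_map_frac eq)
qed

lemma loc_map_id:
  assumes h: "semilinear_map R M M 1 h"
    and eq: "\<And>m. m \<in> carrier M \<Longrightarrow> h m = m"
    and f: "f \<in> carrier R" and u: "u \<in> carrier (loc_module R f M)"
  shows "loc_map R f M 1 h u = u"
proof -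
  interpret h: semilinear_map R M M 1 h by fact
  interpret LM: module_localization R M f by unfold_locales (rule f)
  obtain m n where "m \<in> carrier M" "u = LM.frac m n"
    using u by (rule LM.loc_cases)
  with f h.loc_map_frac[of f m n] show ?thesis
    by (simp add: eq)
qed

section \<open>The Cech complex\<close>

locale cech = module R M for R (structure) and M (structure) +
  fixes fs assumes fs_closed: "set fs \<subseteq> carrier R"
begin

abbreviation C where "C i \<equiv> cech_module R fs M i"

lemma cech_elem_closed:
  assumes "I \<in> cech_index fs i"
  shows "cech_elem R fs I \<in> carrier R"
  using assms fs_closed unfolding cech_elem_def cech_index_def
  by (intro R.finprod_closed) (auto simp: subset_iff)

lemma loc_at: "I \<in> cech_index fs i \<Longrightarrow> module_localization R M (cech_elem R fs I)"
  by unfold_locales (rule cech_elem_closed)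

lemma abelian_group_cech_loc: "I \<in> cech_index fs i \<Longrightarrow> abelian_group (cech_loc R fs M I)"
  by (rule module_localization.abelian_group_loc_module[OF loc_at])

text \<open>The factorization brings the face map from J - {j} to J into the form "from f to f g"
  with g = \<open>fs ! j\<close>, to which the results on \<open>loc_res\<close> apply.\<close>

lemma cech_index_remove:
  assumes "J \<in> cech_index fs (Suc i)" "j \<in> J"
  shows "J - {j} \<in> cech_index fs i" "fs ! j \<in> carrier R"
    and "cech_elem R fs (J - {j}) \<otimes> fs ! j = cech_elem R fs J"
proof -
  have J: "J \<subseteq> {..<length fs}" "card J = Suc i"
    using assms(1) by (auto simp: cech_index_def)
  then have fin: "finite J"
    using finite_subset by blast
  have cl: "(!) fs \<in> J \<rightarrow> carrier R"
    using J(1) fs_closed by (auto simp: subset_iff)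
  show "J - {j} \<in> cech_index fs i" "fs ! j \<in> carrier R"
    using J assms(2) cl fin by (auto simp: cech_index_def)
  have "cech_elem R fs (insert j (J - {j})) = fs ! j \<otimes> cech_elem R fs (J - {j})"
    unfolding cech_elem_def by (rule R.finprod_insert) (use fin cl assms(2) in auto)
  moreover have "insert j (J - {j}) = J"
    using assms(2) by blast
  moreover have "cech_elem R fs (J - {j}) \<in> carrier R"
    unfolding cech_elem_def by (rule R.finprod_closed) (use cl in auto)
  ultimately show "cech_elem R fs (J - {j}) \<otimes> fs ! j = cech_elem R fs J"
    using \<open>fs ! j \<in> carrier R\<close> by (simp add: m_comm)
qed

lemma loc_res_cech_hom:
  assumes "J \<in> cech_index fs (Suc i)" "j \<in> J"
  shows "abelian_group_hom (cech_loc R fs M (J - {j})) (cech_loc R fs M J)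
    (loc_res R (fs ! j) (cech_elem R fs J) M)"
  using module_localization.loc_res_hom[OF loc_at[OF cech_index_remove(1)[OF assms]]
      cech_index_remove(2)[OF assms]]
  by (simp only: cech_index_remove(3)[OF assms])

lemma carrier_cech_module:
  "carrier (C i) = (\<Pi>\<^sub>E I\<in>cech_index fs i. carrier (cech_loc R fs M I))"
  by (simp add: cech_module_def)

lemma cech_closed: "\<lbrakk>\<alpha> \<in> carrier (C i); I \<in> cech_index fs i\<rbrakk> \<Longrightarrow> \<alpha> I \<in> carrier (cech_loc R fs M I)"
  by (auto simp: carrier_cech_module)

lemma cech_eqI:
  assumes "\<alpha> \<in> carrier (C i)" "\<beta> \<in> carrier (C i)" "\<And>I. I \<in> cech_index fs i \<Longrightarrow> \<alpha> I = \<beta> I"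
  shows "\<alpha> = \<beta>"
  using assms unfolding carrier_cech_module by (rule PiE_ext)

lemma cech_add:
  "I \<in> cech_index fs i \<Longrightarrow> (\<alpha> \<oplus>\<^bsub>C i\<^esub> \<beta>) I = \<alpha> I \<oplus>\<^bsub>cech_loc R fs M I\<^esub> \<beta> I"
  by (simp add: cech_module_def)

lemma cech_zero: "I \<in> cech_index fs i \<Longrightarrow> \<zero>\<^bsub>C i\<^esub> I = \<zero>\<^bsub>cech_loc R fs M I\<^esub>"
  by (simp add: cech_module_def)

lemma abelian_group_cech: "abelian_group (C i)"
proof (rule abelian_groupI)
  have add_cl: "\<alpha> \<oplus>\<^bsub>C i\<^esub> \<beta> \<in> carrier (C i)" if "\<alpha> \<in> carrier (C i)" "\<beta> \<in> carrier (C i)" for \<alpha> \<beta>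
    using that abelian_monoid.a_closed[OF abelian_group.axioms(1)[OF abelian_group_cech_loc]]
    by (auto simp: cech_module_def PiE_iff)
  have zero_cl: "\<zero>\<^bsub>C i\<^esub> \<in> carrier (C i)"
    using abelian_monoid.zero_closed[OF abelian_group.axioms(1)[OF abelian_group_cech_loc]]
    by (auto simp: cech_module_def)
  show "\<zero>\<^bsub>C i\<^esub> \<in> carrier (C i)"
    by (rule zero_cl)
  fix \<alpha> assume \<alpha>: "\<alpha> \<in> carrier (C i)"
  show "\<zero>\<^bsub>C i\<^esub> \<oplus>\<^bsub>C i\<^esub> \<alpha> = \<alpha>"
    by (rule cech_eqI[of _ i])
       (use \<alpha> add_cl zero_cl cech_closed abelian_groupE(5)[OF abelian_group_cech_loc] in
        \<open>simp_all add: cech_add cech_zero\<close>)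
  define \<beta> where "\<beta> = (\<lambda>I\<in>cech_index fs i. \<ominus>\<^bsub>cech_loc R fs M I\<^esub> \<alpha> I)"
  have \<beta>: "\<beta> \<in> carrier (C i)"
    using cech_closed[OF \<alpha>] abelian_group.a_inv_closed[OF abelian_group_cech_loc]
    by (auto simp: \<beta>_def carrier_cech_module)
  have "\<beta> \<oplus>\<^bsub>C i\<^esub> \<alpha> = \<zero>\<^bsub>C i\<^esub>"
    by (rule cech_eqI[of _ i])
       (use \<alpha> \<beta> add_cl zero_cl cech_closed abelian_group.l_neg[OF abelian_group_cech_loc] in
        \<open>simp_all add: cech_add cech_zero \<beta>_def\<close>)
  with \<beta> show "\<exists>\<beta>\<in>carrier (C i). \<beta> \<oplus>\<^bsub>C i\<^esub> \<alpha> = \<zero>\<^bsub>C i\<^esub>"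
    by blast
  fix \<beta> assume \<beta>: "\<beta> \<in> carrier (C i)"
  show "\<alpha> \<oplus>\<^bsub>C i\<^esub> \<beta> \<in> carrier (C i)"
    using \<alpha> \<beta> by (rule add_cl)
  show "\<alpha> \<oplus>\<^bsub>C i\<^esub> \<beta> = \<beta> \<oplus>\<^bsub>C i\<^esub> \<alpha>"
    by (rule cech_eqI[of _ i])
       (use \<alpha> \<beta> add_cl cech_closed abelian_groupE(4)[OF abelian_group_cech_loc] in
        \<open>simp_all add: cech_add\<close>)
  fix \<gamma> assume \<gamma>: "\<gamma> \<in> carrier (C i)"
  show "\<alpha> \<oplus>\<^bsub>C i\<^esub> \<beta> \<oplus>\<^bsub>C i\<^esub> \<gamma> = \<alpha> \<oplus>\<^bsub>C i\<^esub> (\<beta> \<oplus>\<^bsub>C i\<^esub> \<gamma>)"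
    by (rule cech_eqI[of _ i])
       (use \<alpha> \<beta> \<gamma> add_cl cech_closed abelian_groupE(3)[OF abelian_group_cech_loc] in
        \<open>simp_all add: cech_add\<close>)
qed

text \<open>One signed summand of the Cech differential, named so that sums over j can be compared
  term by term.\<close>

definition face where
  "face J j \<alpha> = (let v = loc_res R (fs ! j) (cech_elem R fs J) M (\<alpha> (J - {j}))
     in if even (card {k \<in> J. k < j}) then v else \<ominus>\<^bsub>cech_loc R fs M J\<^esub> v)"

lemma cech_diff_apply:
  "J \<in> cech_index fs (Suc i) \<Longrightarrow>
    cech_diff R fs M i \<alpha> J = (\<Oplus>\<^bsub>cech_loc R fs M J\<^esub>j\<in>J. face J j \<alpha>)"
  by (simp add: cech_diff_def face_def)

lemma face_closed:
  assumes "J \<in> cech_index fs (Suc i)" "j \<in> J" "\<alpha> \<in> carrier (C i)"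
  shows "face J j \<alpha> \<in> carrier (cech_loc R fs M J)"
proof -
  interpret abelian_group_hom "cech_loc R fs M (J - {j})" "cech_loc R fs M J"
    "loc_res R (fs ! j) (cech_elem R fs J) M"
    using assms(1,2) by (rule loc_res_cech_hom)
  show ?thesis
    using cech_closed[OF assms(3) cech_index_remove(1)[OF assms(1,2)]]
    by (simp add: face_def Let_def)
qed

lemma face_add:
  assumes "J \<in> cech_index fs (Suc i)" "j \<in> J" "\<alpha> \<in> carrier (C i)" "\<beta> \<in> carrier (C i)"
  shows "face J j (\<alpha> \<oplus>\<^bsub>C i\<^esub> \<beta>) = face J j \<alpha> \<oplus>\<^bsub>cech_loc R fs M J\<^esub> face J j \<beta>"
proof -
  interpret abelian_group_hom "cech_loc R fs M (J - {j})" "cech_loc R fs M J"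
    "loc_res R (fs ! j) (cech_elem R fs J) M"
    using assms(1,2) by (rule loc_res_cech_hom)
  show ?thesis
    using cech_closed[OF assms(3) cech_index_remove(1)[OF assms(1,2)]]
      cech_closed[OF assms(4) cech_index_remove(1)[OF assms(1,2)]]
    by (simp add: face_def Let_def cech_add[OF cech_index_remove(1)[OF assms(1,2)]] H.minus_add)
qed

lemma cech_diff_hom: "abelian_group_hom (C i) (C (Suc i)) (cech_diff R fs M i)"
proof (rule additive_imp_abelian_group_hom[OF abelian_group_cech abelian_group_cech])
  have cl: "cech_diff R fs M i \<alpha> \<in> carrier (C (Suc i))" if "\<alpha> \<in> carrier (C i)" for \<alpha>
  proof -
    have "cech_diff R fs M i \<alpha> J \<in> carrier (cech_loc R fs M J)" if J: "J \<in> cech_index fs (Suc i)" for J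
      unfolding cech_diff_apply[OF J]
      by (rule abelian_monoid.finsum_closed[OF abelian_group.axioms(1)[OF abelian_group_cech_loc[OF J]]])
         (use J face_closed \<open>\<alpha> \<in> carrier (C i)\<close> in blast)
    then show ?thesis
      by (auto simp: carrier_cech_module cech_diff_def)
  qed
  fix \<alpha> \<beta> assume \<alpha>: "\<alpha> \<in> carrier (C i)" and \<beta>: "\<beta> \<in> carrier (C i)"
  show "cech_diff R fs M i \<alpha> \<in> carrier (C (Suc i))"
    using \<alpha> by (rule cl)
  interpret Ci: abelian_group "C i" by (rule abelian_group_cech)
  interpret Cj: abelian_group "C (Suc i)" by (rule abelian_group_cech)
  show "cech_diff R fs M i (\<alpha> \<oplus>\<^bsub>C i\<^esub> \<beta>)
      = cech_diff R fs M i \<alpha> \<oplus>\<^bsub>C (Suc i)\<^esub> cech_diff R fs M i \<beta>"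
  proof (rule cech_eqI[of _ "Suc i"])
    fix J assume J: "J \<in> cech_index fs (Suc i)"
    interpret LJ: abelian_group "cech_loc R fs M J"
      using J by (rule abelian_group_cech_loc)
    have "(\<Oplus>\<^bsub>cech_loc R fs M J\<^esub>j\<in>J. face J j (\<alpha> \<oplus>\<^bsub>C i\<^esub> \<beta>))
        = (\<Oplus>\<^bsub>cech_loc R fs M J\<^esub>j\<in>J. face J j \<alpha> \<oplus>\<^bsub>cech_loc R fs M J\<^esub> face J j \<beta>)"
      by (rule LJ.finsum_cong')
         (use J \<alpha> \<beta> face_add face_closed in \<open>auto simp: Pi_iff\<close>)
    also have "\<dots> = (\<Oplus>\<^bsub>cech_loc R fs M J\<^esub>j\<in>J. face J j \<alpha>)
        \<oplus>\<^bsub>cech_loc R fs M J\<^esub> (\<Oplus>\<^bsub>cech_loc R fs M J\<^esub>j\<in>J. face J j \<beta>)"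
      by (rule LJ.finsum_addf) (use J \<alpha> \<beta> face_closed in \<open>auto simp: Pi_iff\<close>)
    finally show "cech_diff R fs M i (\<alpha> \<oplus>\<^bsub>C i\<^esub> \<beta>) J
        = (cech_diff R fs M i \<alpha> \<oplus>\<^bsub>C (Suc i)\<^esub> cech_diff R fs M i \<beta>) J"
      by (simp add: cech_add[OF J] cech_diff_apply[OF J])
  qed (use \<alpha> \<beta> cl in auto)
qed

lemma additive_subgroup_cocycles: "additive_subgroup (cech_cocycles R fs M i) (C i)"
proof -
  interpret d: abelian_group_hom "C i" "C (Suc i)" "cech_diff R fs M i"
    by (rule cech_diff_hom)
  have "cech_cocycles R fs M i = a_kernel (C i) (C (Suc i)) (cech_diff R fs M i)"
    unfolding cech_cocycles_def a_kernel_def' ..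
  then show ?thesis
    by (rule ssubst) (rule d.additive_subgroup_a_kernel)
qed

lemma additive_subgroup_coboundaries: "additive_subgroup (cech_coboundaries R fs M i) (C i)"
proof (cases i)
  case 0
  interpret abelian_group "C 0" by (rule abelian_group_cech)
  show ?thesis
    unfolding 0 cech_coboundaries_def
    by (simp add: additive_subgroupI add.triv_subgroup)
next
  case (Suc j)
  interpret d: abelian_group_hom "C j" "C (Suc j)" "cech_diff R fs M j"
    by (rule cech_diff_hom)
  show ?thesis
    unfolding Suc cech_coboundaries_def
    using group_hom.img_is_subgroup[OF d.a_group_hom]
    by (simp add: additive_subgroupI)
qed

end

section \<open>Maps of Cech complexes\<close>

locale cech_semilinear = semilinear_map R M N q h + MC: cech R M fs + NC: cech R N fs
  for R (structure) and M (structure) and N (structure) and q h fs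
begin

abbreviation \<phi> where "\<phi> i \<equiv> cech_map R fs N i q h"

lemma cech_map_apply:
  "I \<in> cech_index fs i \<Longrightarrow> \<phi> i \<alpha> I = loc_map R (cech_elem R fs I) N q h (\<alpha> I)"
  by (simp add: cech_map_def)

lemma cech_map_hom: "abelian_group_hom (MC.C i) (NC.C i) (\<phi> i)"
proof (rule additive_imp_abelian_group_hom[OF MC.abelian_group_cech NC.abelian_group_cech])
  have hom: "abelian_group_hom (cech_loc R fs M I) (cech_loc R fs N I)
      (loc_map R (cech_elem R fs I) N q h)" if "I \<in> cech_index fs i" for I
    by (rule loc_map_hom[OF MC.cech_elem_closed[OF that]])
  have cl: "\<phi> i \<alpha> \<in> carrier (NC.C i)" if "\<alpha> \<in> carrier (MC.C i)" for \<alpha>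
    using MC.cech_closed[OF that] abelian_group_hom.hom_closed[OF hom]
    by (auto simp: NC.carrier_cech_module cech_map_def)
  fix \<alpha> \<beta> assume \<alpha>: "\<alpha> \<in> carrier (MC.C i)" and \<beta>: "\<beta> \<in> carrier (MC.C i)"
  show "\<phi> i \<alpha> \<in> carrier (NC.C i)"
    using \<alpha> by (rule cl)
  show "\<phi> i (\<alpha> \<oplus>\<^bsub>MC.C i\<^esub> \<beta>) = \<phi> i \<alpha> \<oplus>\<^bsub>NC.C i\<^esub> \<phi> i \<beta>"
  proof (rule NC.cech_eqI[of _ i])
    fix I assume I: "I \<in> cech_index fs i"
    show "\<phi> i (\<alpha> \<oplus>\<^bsub>MC.C i\<^esub> \<beta>) I = (\<phi> i \<alpha> \<oplus>\<^bsub>NC.C i\<^esub> \<phi> i \<beta>) I"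
      using abelian_group_hom.hom_add[OF hom[OF I] MC.cech_closed[OF \<alpha> I] MC.cech_closed[OF \<beta> I]]
      by (simp add: cech_map_apply MC.cech_add NC.cech_add I)
  qed (use \<alpha> \<beta> cl abelian_groupE(1)[OF MC.abelian_group_cech] abelian_groupE(1)[OF NC.abelian_group_cech]
       in auto)
qed

text \<open>It suffices to compare single faces. Restriction commutes with the localized map by
  \<open>loc_map_res\<close>. The sign passes through by additivity; treating it as the scalar -1
  would turn it into (-1)^q.\<close>

lemma cech_map_diff:
  assumes \<alpha>: "\<alpha> \<in> carrier (MC.C i)"
  shows "\<phi> (Suc i) (cech_diff R fs M i \<alpha>) = cech_diff R fs N i (\<phi> i \<alpha>)"
proof (rule NC.cech_eqI[of _ "Suc i"])
  fix J assume J: "J \<in> cech_index fs (Suc i)"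
  interpret \<phi>J: abelian_group_hom "cech_loc R fs M J" "cech_loc R fs N J"
      "loc_map R (cech_elem R fs J) N q h"
    by (rule loc_map_hom[OF MC.cech_elem_closed[OF J]])
  have face: "loc_map R (cech_elem R fs J) N q h (MC.face J j \<alpha>) = NC.face J j (\<phi> i \<alpha>)"
    if j: "j \<in> J" for j
  proof -
    note J' = MC.cech_index_remove[OF J j]
    have "loc_res R (fs ! j) (cech_elem R fs J) M (\<alpha> (J - {j})) \<in> carrier (cech_loc R fs M J)"
      by (rule abelian_group_hom.hom_closed[OF MC.loc_res_cech_hom[OF J j]
            MC.cech_closed[OF \<alpha> J'(1)]])
    then show ?thesis
      using loc_map_res[OF MC.cech_elem_closed[OF J'(1)] J'(2) MC.cech_closed[OF \<alpha> J'(1)]]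
      unfolding J'(3) MC.face_def NC.face_def Let_def by (simp add: cech_map_apply[OF J'(1)])
  qed
  have "\<phi> (Suc i) (cech_diff R fs M i \<alpha>) J
      = (\<Oplus>\<^bsub>cech_loc R fs N J\<^esub>j\<in>J. loc_map R (cech_elem R fs J) N q h (MC.face J j \<alpha>))"
    unfolding cech_map_apply[OF J] MC.cech_diff_apply[OF J]
    by (rule \<phi>J.hom_finsum) (use MC.face_closed[OF J _ \<alpha>] in blast)
  also have "\<dots> = (\<Oplus>\<^bsub>cech_loc R fs N J\<^esub>j\<in>J. NC.face J j (\<phi> i \<alpha>))"
    by (rule \<phi>J.H.finsum_cong')
       (use face NC.face_closed[OF J _ abelian_group_hom.hom_closed[OF cech_map_hom \<alpha>]] in auto)
  finally show "\<phi> (Suc i) (cech_diff R fs M i \<alpha>) J = cech_diff R fs N i (\<phi> i \<alpha>) J"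
    by (simp add: NC.cech_diff_apply[OF J])
qed (use \<alpha> abelian_group_hom.hom_closed[OF cech_map_hom]
      abelian_group_hom.hom_closed[OF MC.cech_diff_hom]
      abelian_group_hom.hom_closed[OF NC.cech_diff_hom] in auto)

lemma cech_map_cocycles: "\<phi> i ` cech_cocycles R fs M i \<subseteq> cech_cocycles R fs N i"
proof
  fix \<beta> assume "\<beta> \<in> \<phi> i ` cech_cocycles R fs M i"
  then obtain \<alpha> where \<alpha>: "\<alpha> \<in> carrier (MC.C i)" "cech_diff R fs M i \<alpha> = \<zero>\<^bsub>MC.C (Suc i)\<^esub>" "\<beta> = \<phi> i \<alpha>"
    by (auto simp: cech_cocycles_def)
  then show "\<beta> \<in> cech_cocycles R fs N i"
    using abelian_group_hom.hom_closed[OF cech_map_hom \<alpha>(1)] cech_map_diff[OF \<alpha>(1)]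
      abelian_group_hom.hom_zero[OF cech_map_hom, of "Suc i"]
    by (simp add: cech_cocycles_def)
qed

lemma cech_map_coboundaries: "\<phi> i ` cech_coboundaries R fs M i \<subseteq> cech_coboundaries R fs N i"
proof (cases i)
  case 0
  then show ?thesis
    using abelian_group_hom.hom_zero[OF cech_map_hom, of 0] by (simp add: cech_coboundaries_def)
next
  case (Suc j)
  then show ?thesis
    using abelian_group_hom.hom_closed[OF cech_map_hom]
    by (auto simp: cech_coboundaries_def cech_map_diff)
qed

end

section \<open>Functoriality of local cohomology\<close>

text \<open>
  The subgroup \<open>B\<close> need not lie in \<open>Z\<close>: the cosets \<open>B + z\<close> with \<open>z \<in> Z\<close> form a subgroup of
  \<open>G/B\<close> anyway. This makes the identity \<open>d \<circ> d = 0\<close> of the Cech complex dispensable.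
\<close>

locale subquotient = abelian_group G for G :: "('a, 'c, 'm) module_scheme" (structure) +
  fixes Z B
  assumes Z: "additive_subgroup Z G" and B: "additive_subgroup B G"
begin

abbreviation Q where "Q \<equiv> quot_module (G\<lparr>carrier := Z\<rparr>) B"

lemma Z_closed: "z \<in> Z \<Longrightarrow> z \<in> carrier G"
  using additive_subgroup.a_subset[OF Z] by blast

lemma abelian_subgroup_B: "abelian_subgroup B G"
  using B abelian_group_axioms by (rule abelian_subgroupI3)

lemma coset_restrict: "B +>\<^bsub>G\<lparr>carrier := Z\<rparr>\<^esub> z = B +> z"
  by (simp add: a_r_coset_def r_coset_def)

lemma carrier_Q: "carrier Q = (\<lambda>z. B +> z) ` Z"
  by (auto simp: quot_module_def A_RCOSETS_def' coset_restrict)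

lemma add_Q:
  assumes "z \<in> carrier G" "w \<in> carrier G"
  shows "(B +> z) \<oplus>\<^bsub>Q\<^esub> (B +> w) = B +> (z \<oplus> w)"
  using abelian_subgroup.a_rcos_sum[OF abelian_subgroup_B assms]
  by (simp add: quot_module_def set_add_def set_mult_def)

lemma zero_Q: "\<zero>\<^bsub>Q\<^esub> = B +> \<zero>"
  using additive_subgroup.a_subset[OF B] by (simp add: quot_module_def)

lemma abelian_group_Q: "abelian_group Q"
proof (rule abelian_groupI)
  fix U V assume "U \<in> carrier Q" "V \<in> carrier Q"
  then obtain z w where "z \<in> Z" "w \<in> Z" "U = B +> z" "V = B +> w"
    unfolding carrier_Q by blast
  then show "U \<oplus>\<^bsub>Q\<^esub> V \<in> carrier Q" "U \<oplus>\<^bsub>Q\<^esub> V = V \<oplus>\<^bsub>Q\<^esub> U"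
    using additive_subgroup.a_subset[OF Z] subgroup.m_closed[OF additive_subgroup.a_subgroup[OF Z]]
    by (auto simp: add_Q Z_closed a_comm carrier_Q)
next
  fix U V W assume "U \<in> carrier Q" "V \<in> carrier Q" "W \<in> carrier Q"
  then obtain u v w where "u \<in> Z" "v \<in> Z" "w \<in> Z" "U = B +> u" "V = B +> v" "W = B +> w"
    unfolding carrier_Q by blast
  then show "U \<oplus>\<^bsub>Q\<^esub> V \<oplus>\<^bsub>Q\<^esub> W = U \<oplus>\<^bsub>Q\<^esub> (V \<oplus>\<^bsub>Q\<^esub> W)"
    by (simp add: add_Q Z_closed a_assoc)
next
  show "\<zero>\<^bsub>Q\<^esub> \<in> carrier Q"
    unfolding zero_Q carrier_Q using additive_subgroup.zero_closed[OF Z] by blast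
next
  fix U assume "U \<in> carrier Q"
  then obtain u where u: "u \<in> Z" "U = B +> u"
    unfolding carrier_Q by blast
  then show "\<zero>\<^bsub>Q\<^esub> \<oplus>\<^bsub>Q\<^esub> U = U"
    unfolding zero_Q by (simp add: add_Q Z_closed)
  have "(B +> (\<ominus> u)) \<oplus>\<^bsub>Q\<^esub> U = \<zero>\<^bsub>Q\<^esub>"
    unfolding zero_Q u(2) using u(1) by (simp add: add_Q Z_closed l_neg)
  moreover have "B +> (\<ominus> u) \<in> carrier Q"
    unfolding carrier_Q using additive_subgroup.a_inv_closed[OF Z u(1)] by blast
  ultimately show "\<exists>V\<in>carrier Q. V \<oplus>\<^bsub>Q\<^esub> U = \<zero>\<^bsub>Q\<^esub>"
    by blast
qed

end

text \<open>Representatives of one coset differ by some b in B, and h b lies in B', so their images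
  lie in one coset of B'. The union over the nonempty coset therefore collapses. This serves
  cohomology classes and quotient rings alike.\<close>

lemma induced_map_coset:
  assumes h: "abelian_group_hom G G' h" and B: "additive_subgroup B G"
    and B': "additive_subgroup B' G'" and hB: "h ` B \<subseteq> B'" and z: "z \<in> carrier G"
  shows "induced_map G' B' h (B +>\<^bsub>G\<^esub> z) = B' +>\<^bsub>G'\<^esub> h z"
proof -
  interpret h: abelian_group_hom G G' h by fact
  interpret B: additive_subgroup B G by fact
  interpret B': additive_subgroup B' G' by fact
  interpret B': abelian_subgroup B' G'
    using B' h.H.abelian_group_axioms by (rule abelian_subgroupI3)
  have "B' +>\<^bsub>G'\<^esub> h (b \<oplus>\<^bsub>G\<^esub> z) = B' +>\<^bsub>G'\<^esub> h z" if b: "b \<in> B" for b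
  proof -
    have bG: "b \<in> carrier G" and hb: "h b \<in> B'" and hbG: "h b \<in> carrier G'"
      using b B.a_subset hB by auto
    have "B' +>\<^bsub>G'\<^esub> h (b \<oplus>\<^bsub>G\<^esub> z) = (B' +>\<^bsub>G'\<^esub> h b) +>\<^bsub>G'\<^esub> h z"
      using h.H.a_coset_add_assoc[OF B'.a_subset hbG h.hom_closed[OF z]] h.hom_add[OF bG z] by simp
    then show ?thesis
      using B'.a_rcos_const[OF hb] by simp
  qed
  moreover have "B +>\<^bsub>G\<^esub> z = (\<lambda>b. b \<oplus>\<^bsub>G\<^esub> z) ` B"
    by (auto simp: a_r_coset_def')
  moreover have "B \<noteq> {}"
    using B.zero_closed by blast
  ultimately show ?thesis
    by (auto simp: induced_map_def)
qed

lemma subquotient_map_hom: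
  assumes h: "abelian_group_hom G G' h" and G: "subquotient G Z B" and G': "subquotient G' Z' B'"
    and hZ: "h ` Z \<subseteq> Z'" and hB: "h ` B \<subseteq> B'"
  shows "abelian_group_hom (subquotient.Q G Z B) (subquotient.Q G' Z' B') (induced_map G' B' h)"
proof -
  interpret h: abelian_group_hom G G' h by fact
  interpret S: subquotient G Z B by fact
  interpret T: subquotient G' Z' B' by fact
  note coset = induced_map_coset[OF h S.B T.B hB]
  show ?thesis
  proof (rule additive_imp_abelian_group_hom[OF S.abelian_group_Q T.abelian_group_Q])
    fix U V assume "U \<in> carrier S.Q" "V \<in> carrier S.Q"
    then obtain z w where *: "z \<in> Z" "w \<in> Z" "U = B +>\<^bsub>G\<^esub> z" "V = B +>\<^bsub>G\<^esub> w"
      unfolding S.carrier_Q by blast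
    show "induced_map G' B' h U \<in> carrier T.Q"
      using hZ * by (auto simp: coset S.Z_closed T.carrier_Q)
    show "induced_map G' B' h (U \<oplus>\<^bsub>S.Q\<^esub> V) = induced_map G' B' h U \<oplus>\<^bsub>T.Q\<^esub> induced_map G' B' h V"
      using * by (simp add: coset S.Z_closed S.add_Q T.add_Q)
  qed
qed

lemma cech_semilinearI:
  "semilinear_map R M N q h \<Longrightarrow> set fs \<subseteq> carrier R \<Longrightarrow> cech_semilinear R M N q h fs"
  by (simp add: cech_semilinear_def cech_def cech_axioms_def semilinear_map_def)

context cech
begin

abbreviation H where "H i \<equiv> local_cohomology R fs M i"

abbreviation cls where "cls i z \<equiv> cech_coboundaries R fs M i +>\<^bsub>C i\<^esub> z"

lemma subquotient_H: "subquotient (C i) (cech_cocycles R fs M i) (cech_coboundaries R fs M i)"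
  by (intro subquotient.intro subquotient_axioms.intro abelian_group_cech
      additive_subgroup_cocycles additive_subgroup_coboundaries)

lemma cocycles_closed: "z \<in> cech_cocycles R fs M i \<Longrightarrow> z \<in> carrier (C i)"
  by (simp add: cech_cocycles_def)

lemma carrier_H: "carrier (H i) = cls i ` cech_cocycles R fs M i"
  unfolding local_cohomology_def by (rule subquotient.carrier_Q[OF subquotient_H])

text \<open>The representative is returned as a cochain, which is all that the formula for an
  induced map on classes asks for.\<close>

lemma H_cases:
  assumes "U \<in> carrier (H i)"
  obtains z where "z \<in> carrier (C i)" "U = cls i z"
  using assms cocycles_closed unfolding carrier_H by blast

end

context cech_semilinear
begin

lemma local_cohomology_map_cls:
  "z \<in> carrier (MC.C i) \<Longrightarrow> local_cohomology_map R fs N i q h (MC.cls i z) = NC.cls i (\<phi> i z)"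
  unfolding local_cohomology_map_def
  by (rule induced_map_coset[OF cech_map_hom MC.additive_subgroup_coboundaries
        NC.additive_subgroup_coboundaries cech_map_coboundaries])

lemma local_cohomology_map_hom:
  "abelian_group_hom (MC.H i) (NC.H i) (local_cohomology_map R fs N i q h)"
  unfolding local_cohomology_def local_cohomology_map_def
  by (rule subquotient_map_hom[OF cech_map_hom MC.subquotient_H NC.subquotient_H
        cech_map_cocycles cech_map_coboundaries])

end

section \<open>Identities between induced maps\<close>

lemma local_cohomology_map_comp:
  assumes h: "semilinear_map R M N q h" and h': "semilinear_map R N P q' h'"
    and fs: "set fs \<subseteq> carrier R" and U: "U \<in> carrier (local_cohomology R fs M i)"
  shows "local_cohomology_map R fs P i q' h' (local_cohomology_map R fs N i q h U)
    = local_cohomology_map R fs P i (q' * q) (\<lambda>m. h' (h m)) U"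
proof -
  interpret h: cech_semilinear R M N q h fs
    using h fs by (rule cech_semilinearI)
  interpret h': cech_semilinear R N P q' h' fs
    using h' fs by (rule cech_semilinearI)
  interpret c: cech_semilinear R M P "q' * q" "\<lambda>m. h' (h m)" fs
    using semilinear_map_comp[OF h h'] fs by (rule cech_semilinearI)
  obtain z where z: "z \<in> carrier (h.MC.C i)" "U = h.MC.cls i z"
    using U by (rule h.MC.H_cases)
  \<comment> \<open>The identity already holds for cochains, component by component, before passing
    to classes.\<close>
  have "h'.\<phi> i (h.\<phi> i z) = c.\<phi> i z"
    unfolding cech_map_def
    by (rule restrict_ext)
       (use loc_map_comp[OF h h' h.MC.cech_elem_closed h.MC.cech_closed[OF z(1)]] in simp)
  then show ?thesis
    unfolding z(2)
    using abelian_group_hom.hom_closed[OF h.cech_map_hom z(1)]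
    by (simp add: h.local_cohomology_map_cls h'.local_cohomology_map_cls
        c.local_cohomology_map_cls z(1))
qed

text \<open>Two functions that describe the same module map may differ outside the carrier, so they
  cannot simply be rewritten into each other inside an induced map.\<close>

lemma local_cohomology_map_cong:
  assumes h: "semilinear_map R M N q h" and h': "semilinear_map R M N q h'"
    and eq: "\<And>m. m \<in> carrier M \<Longrightarrow> h m = h' m"
    and fs: "set fs \<subseteq> carrier R" and U: "U \<in> carrier (local_cohomology R fs M i)"
  shows "local_cohomology_map R fs N i q h U = local_cohomology_map R fs N i q h' U"
proof -
  interpret h: cech_semilinear R M N q h fs
    using h fs by (rule cech_semilinearI)
  interpret h': cech_semilinear R M N q h' fs
    using h' fs by (rule cech_semilinearI)
  obtain z where z: "z \<in> carrier (h.MC.C i)" "U = h.MC.cls i z"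
    using U by (rule h.MC.H_cases)
  have "h.\<phi> i z = h'.\<phi> i z"
    unfolding cech_map_def
    by (rule restrict_ext)
       (use loc_map_cong[OF h h' eq h.MC.cech_elem_closed h.MC.cech_closed[OF z(1)]] in simp)
  then show ?thesis
    unfolding z(2) by (simp add: h.local_cohomology_map_cls h'.local_cohomology_map_cls z(1))
qed

text \<open>Serves the base case of the main induction: the projection from R/x to itself is a union
  of cosets, which equals its argument when that is a coset.\<close>

lemma local_cohomology_map_id:
  assumes h: "semilinear_map R M M 1 h"
    and eq: "\<And>m. m \<in> carrier M \<Longrightarrow> h m = m"
    and fs: "set fs \<subseteq> carrier R" and U: "U \<in> carrier (local_cohomology R fs M i)"
  shows "local_cohomology_map R fs M i 1 h U = U"
proof -
  interpret h: cech_semilinear R M M 1 h fs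
    using h fs by (rule cech_semilinearI)
  obtain z where z: "z \<in> carrier (h.MC.C i)" "U = h.MC.cls i z"
    using U by (rule h.MC.H_cases)
  have "h.\<phi> i z = z"
  proof (rule h.MC.cech_eqI[of _ i])
    fix I assume I: "I \<in> cech_index fs i"
    show "h.\<phi> i z I = z I"
      unfolding h.cech_map_apply[OF I]
      by (rule loc_map_id[OF h eq h.MC.cech_elem_closed[OF I] h.MC.cech_closed[OF z(1) I]])
  qed (use z(1) abelian_group_hom.hom_closed[OF h.cech_map_hom] in auto)
  then show ?thesis
    unfolding z(2) by (simp only: h.local_cohomology_map_cls[OF z(1)])
qed

text \<open>The scalar action on classes is itself an induced map, namely that of componentwise
  multiplication by r on cochains, and componentwise multiplication is the Cech map of m -> r
  m.\<close>

lemma local_cohomology_smult: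
  assumes "module R M" and fs: "set fs \<subseteq> carrier R" and r: "r \<in> carrier R"
    and U: "U \<in> carrier (local_cohomology R fs M i)"
  shows "r \<odot>\<^bsub>local_cohomology R fs M i\<^esub> U
    = local_cohomology_map R fs M i 1 (\<lambda>m. r \<odot>\<^bsub>M\<^esub> m) U"
proof -
  interpret module R M by fact
  interpret r: cech_semilinear R M M 1 "\<lambda>m. r \<odot>\<^bsub>M\<^esub> m" fs
    using semilinear_map_smult[OF r] fs by (rule cech_semilinearI)
  obtain z where z: "z \<in> carrier (r.MC.C i)" "U = r.MC.cls i z"
    using U by (rule r.MC.H_cases)
  have smult: "r \<odot>\<^bsub>r.MC.C i\<^esub> w = r.\<phi> i w" if w: "w \<in> carrier (r.MC.C i)" for w
  proof -
    have "r \<odot>\<^bsub>r.MC.C i\<^esub> w = (\<lambda>I\<in>cech_index fs i. r \<odot>\<^bsub>cech_loc R fs M I\<^esub> w I)"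
      by (simp add: cech_module_def)
    also have "\<dots> = r.\<phi> i w"
      unfolding cech_map_def
      by (rule restrict_ext)
         (use module_localization.loc_map_smult[OF r.MC.loc_at r r.MC.cech_closed[OF w]] in simp)
    finally show ?thesis .
  qed
  \<comment> \<open>\<open>smult\<close> compares the two actions on cochains only, so every member
    of the coset U must be known to be one.\<close>
  have U_closed: "U \<subseteq> carrier (r.MC.C i)"
    unfolding z(2)
    by (rule abelian_monoid.a_r_coset_subset_G[OF abelian_group.axioms(1)[OF r.MC.abelian_group_cech]
          additive_subgroup.a_subset[OF r.MC.additive_subgroup_coboundaries] z(1)])
  have "r \<odot>\<^bsub>r.MC.H i\<^esub> U
      = (\<Union>w\<in>U. cech_coboundaries R fs M i +>\<^bsub>r.MC.C i\<^esub> (r \<odot>\<^bsub>r.MC.C i\<^esub> w))"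
    by (simp add: local_cohomology_def quot_module_def induced_map_def
        subquotient.coset_restrict[OF r.MC.subquotient_H])
  also have "\<dots> = local_cohomology_map R fs M i 1 (\<lambda>m. r \<odot>\<^bsub>M\<^esub> m) U"
    unfolding local_cohomology_map_def induced_map_def
    by (rule SUP_cong) (use U_closed smult in auto)
  finally show ?thesis .
qed

text \<open>If V is the image of U, then r V is the image of r U, because h commutes with
  multiplication by r. Written with induced maps, this takes two uses of functoriality around one
  congruence.\<close>

lemma submodule_local_cohomology_image:
  assumes h: "semilinear_map R M N 1 h" and fs: "set fs \<subseteq> carrier R"
  shows "submodule (local_cohomology_map R fs N i 1 h ` carrier (local_cohomology R fs M i))
    R (local_cohomology R fs N i)"
proof -
  interpret h: cech_semilinear R M N 1 h fs
    using h fs by (rule cech_semilinearI)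
  interpret \<psi>: abelian_group_hom "h.MC.H i" "h.NC.H i" "local_cohomology_map R fs N i 1 h"
    by (rule h.local_cohomology_map_hom)
  show ?thesis
  proof (intro submodule.intro submodule_axioms.intro)
    show "subgroup (local_cohomology_map R fs N i 1 h ` carrier (h.MC.H i)) (add_monoid (h.NC.H i))"
      using group_hom.img_is_subgroup[OF \<psi>.a_group_hom] by simp
    fix r V
    assume r: "r \<in> carrier R" and "V \<in> local_cohomology_map R fs N i 1 h ` carrier (h.MC.H i)"
    then obtain U where U: "U \<in> carrier (h.MC.H i)" and V: "V = local_cohomology_map R fs N i 1 h U"
      by blast
    have rM: "semilinear_map R M M 1 (\<lambda>m. r \<odot>\<^bsub>M\<^esub> m)" and rN: "semilinear_map R N N 1 (\<lambda>m. r \<odot>\<^bsub>N\<^esub> m)"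
      using r by (rule h.M.semilinear_map_smult h.N.semilinear_map_smult)+
    have "r \<odot>\<^bsub>h.NC.H i\<^esub> V = local_cohomology_map R fs N i 1 (\<lambda>m. r \<odot>\<^bsub>N\<^esub> m) V"
      unfolding V using \<psi>.hom_closed[OF U]
      by (rule local_cohomology_smult[OF h.N.module_axioms fs r])
    also have "\<dots> = local_cohomology_map R fs N i (1 * 1) (\<lambda>m. r \<odot>\<^bsub>N\<^esub> h m) U"
      unfolding V by (rule local_cohomology_map_comp[OF h rN fs U])
    \<comment> \<open>Linearity of h enters here. The exponent stays in the form
      \<open>1 * 1\<close> in which composition delivers it.\<close>
    also have "\<dots> = local_cohomology_map R fs N i (1 * 1) (\<lambda>m. h (r \<odot>\<^bsub>M\<^esub> m)) U"
      by (rule local_cohomology_map_cong[OF semilinear_map_comp[OF h rN]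
            semilinear_map_comp[OF rM h] _ fs U])
         (simp add: h.h_smult r)
    also have "\<dots> = local_cohomology_map R fs N i 1 h (local_cohomology_map R fs M i 1 (\<lambda>m. r \<odot>\<^bsub>M\<^esub> m) U)"
      by (rule local_cohomology_map_comp[OF rM h fs U, symmetric])
    finally show "r \<odot>\<^bsub>h.NC.H i\<^esub> V \<in> local_cohomology_map R fs N i 1 h ` carrier (h.MC.H i)"
      using abelian_group_hom.hom_closed[OF cech_semilinear.local_cohomology_map_hom
          [OF cech_semilinearI[OF rM fs]] U]
      by blast
  qed
qed

section \<open>Frobenius in prime characteristic\<close>

text \<open>Pascal's rule: with t k = a^k b^(n+1-k), multiplying the k-th term for n by b gives t k,
  and multiplying it by a gives t (k+1).\<close>

lemma (in cring) binomial_finsum: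
  assumes a: "a \<in> carrier R" and b: "b \<in> carrier R"
  shows "(a \<oplus> b) [^] n = (\<Oplus>k\<in>{..n}. [(n choose k)] \<cdot> (a [^] k \<otimes> b [^] (n - k)))"
proof (induction n)
  case (Suc n)
  define t where "t k = a [^] k \<otimes> b [^] (Suc n - k)" for k
  have t: "t k \<in> carrier R" for k
    using a b by (simp add: t_def)
  have tb: "b \<otimes> (a [^] k \<otimes> b [^] (n - k)) = t k" if "k \<le> n" for k
    using a b that by (simp add: t_def Suc_diff_le m_ac)
  have ta: "a \<otimes> (a [^] k \<otimes> b [^] (n - k)) = t (Suc k)" for k
    using a b by (simp add: t_def m_ac)
  have "(a \<oplus> b) [^] Suc n = (a \<oplus> b) \<otimes> (\<Oplus>k\<in>{..n}. [(n choose k)] \<cdot> (a [^] k \<otimes> b [^] (n - k)))"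
    using a b Suc.IH by (simp add: m_comm)
  also have "\<dots> = (\<Oplus>k\<in>{..n}. (a \<oplus> b) \<otimes> ([(n choose k)] \<cdot> (a [^] k \<otimes> b [^] (n - k))))"
    using a b by (intro finsum_rdistr) auto
  also have "\<dots> = (\<Oplus>k\<in>{..n}. [(n choose k)] \<cdot> t (Suc k) \<oplus> [(n choose k)] \<cdot> t k)"
    by (rule finsum_cong') (use a b t in \<open>auto simp: l_distr add_pow_rdistr ta tb add.nat_pow_distrib\<close>)
  also have "\<dots> = (\<Oplus>k\<in>{..n}. [(n choose k)] \<cdot> t (Suc k)) \<oplus> (\<Oplus>k\<in>{..n}. [(n choose k)] \<cdot> t k)"
    using t by (intro finsum_addf) auto
  \<comment> \<open>The added term k = n + 1 has coefficient 0. With it, splitting off k = 0 leaves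
    a sum of the terms t (k+1) over the same range as the other sum, ready for Pascal's
    rule.\<close>
  also have "(\<Oplus>k\<in>{..n}. [(n choose k)] \<cdot> t k) = (\<Oplus>k\<in>{..Suc n}. [(n choose k)] \<cdot> t k)"
    using t by (subst finsum_Suc) (auto simp: binomial_eq_0)
  also have "\<dots> = (\<Oplus>k\<in>{..n}. [(n choose Suc k)] \<cdot> t (Suc k)) \<oplus> t 0"
    using t by (subst finsum_Suc2) auto
  also have "(\<Oplus>k\<in>{..n}. [(n choose k)] \<cdot> t (Suc k)) \<oplus> ((\<Oplus>k\<in>{..n}. [(n choose Suc k)] \<cdot> t (Suc k)) \<oplus> t 0)
      = ((\<Oplus>k\<in>{..n}. [(n choose k)] \<cdot> t (Suc k)) \<oplus> (\<Oplus>k\<in>{..n}. [(n choose Suc k)] \<cdot> t (Suc k))) \<oplus> t 0"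
    using t by (intro a_assoc[symmetric] finsum_closed) auto
  also have "(\<Oplus>k\<in>{..n}. [(n choose k)] \<cdot> t (Suc k)) \<oplus> (\<Oplus>k\<in>{..n}. [(n choose Suc k)] \<cdot> t (Suc k))
      = (\<Oplus>k\<in>{..n}. [(n choose k)] \<cdot> t (Suc k) \<oplus> [(n choose Suc k)] \<cdot> t (Suc k))"
    using t by (intro finsum_addf[symmetric]) auto
  also have "\<dots> = (\<Oplus>k\<in>{..n}. [(Suc n choose Suc k)] \<cdot> t (Suc k))"
    by (rule finsum_cong') (use t in \<open>auto simp: add.nat_pow_mult\<close>)
  also have "\<dots> \<oplus> t 0 = (\<Oplus>k\<in>{..Suc n}. [(Suc n choose k)] \<cdot> t k)"
    using t by (subst finsum_Suc2) auto
  finally show ?case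
    unfolding t_def .
qed (use a b in simp)

text \<open>For 0 < k < p the prime p divides p choose k, and multiples of p annihilate the ring
  because [p] 1 = 0. Only the two end terms of the binomial sum survive.\<close>

lemma (in cring) prime_char_add_pow:
  assumes p: "Factorial_Ring.prime p" and char: "[p] \<cdot> \<one> = \<zero>"
    and a: "a \<in> carrier R" and b: "b \<in> carrier R"
  shows "(a \<oplus> b) [^] p = a [^] p \<oplus> b [^] (p :: nat)"
proof -
  define t where "t k = [(p choose k)] \<cdot> (a [^] k \<otimes> b [^] (p - k))" for k
  have t: "t k \<in> carrier R" for k
    using a b by (simp add: t_def)
  obtain q where q: "p = Suc q"
    using prime_gt_0_nat[OF p] gr0_conv_Suc by blast
  have zero: "t (Suc k) = \<zero>" if "k < q" for k
  proof -
    have "p dvd (p choose Suc k)"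
      using that p prime_gt_0_nat[OF p] by (intro dvd_choose_prime) (auto simp: q)
    then obtain c where c: "p choose Suc k = p * c" ..
    define y where "y = a [^] Suc k \<otimes> b [^] (p - Suc k)"
    have y: "y \<in> carrier R"
      using a b unfolding y_def by simp
    have "add_pow R (p * c) y = add_pow R c (add_pow R p y)"
      using y by (simp add: add.nat_pow_pow)
    also have "add_pow R p y = add_pow R p \<one> \<otimes> y"
      using y add_pow_ldistr[of \<one> y p] by simp
    finally have "add_pow R (p * c) y = \<zero>"
      using y by (simp add: char)
    then show ?thesis
      unfolding t_def c y_def .
  qed
  have "(a \<oplus> b) [^] p = (\<Oplus>k\<in>{..Suc q}. t k)"
    unfolding binomial_finsum[OF a b] t_def q ..
  also have "\<dots> = (\<Oplus>k\<in>{..q}. t (Suc k)) \<oplus> t 0"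
    using t by (intro finsum_Suc2) auto
  \<comment> \<open>Since p = q + 1, the index q stands for the end term k = p.\<close>
  also have "(\<Oplus>k\<in>{..q}. t (Suc k)) = (\<Oplus>k\<in>{..q}. if q = k then t (Suc k) else \<zero>)"
    by (rule finsum_cong') (use t zero in auto)
  also have "\<dots> = t (Suc q)"
    using t by (intro finsum_singleton) auto
  finally show ?thesis
    using a b by (simp add: t_def q)
qed

section \<open>Maps between quotient rings\<close>

locale quotient_algebra = cring R + ideal I R for R (structure) and I
begin

abbreviation A where "A \<equiv> quot_algebra R I"

lemma carrier_A: "carrier A = (\<lambda>a. I +> a) ` carrier R"
  unfolding quot_algebra_def FactRing_def A_RCOSETS_def' by auto

lemma coset_in_A [simp]: "a \<in> carrier R \<Longrightarrow> I +> a \<in> carrier A"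
  by (simp add: carrier_A)

lemma A_add: "\<lbrakk>a \<in> carrier R; b \<in> carrier R\<rbrakk> \<Longrightarrow> (I +> a) \<oplus>\<^bsub>A\<^esub> (I +> b) = I +> (a \<oplus> b)"
  by (simp add: quot_algebra_def FactRing_def a_rcos_sum)

lemma A_mult: "\<lbrakk>a \<in> carrier R; b \<in> carrier R\<rbrakk> \<Longrightarrow> (I +> a) \<otimes>\<^bsub>A\<^esub> (I +> b) = I +> (a \<otimes> b)"
  by (simp add: quot_algebra_def FactRing_def rcoset_mult_add)

lemma A_smult: "\<lbrakk>r \<in> carrier R; a \<in> carrier R\<rbrakk> \<Longrightarrow> r \<odot>\<^bsub>A\<^esub> (I +> a) = I +> (r \<otimes> a)"
  by (simp add: quot_algebra_def FactRing_def rcoset_mult_add)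

lemma A_pow:
  assumes "a \<in> carrier R"
  shows "(I +> a) [^]\<^bsub>A\<^esub> (n::nat) = I +> (a [^] n)"
proof (induction n)
  case 0
  show ?case
    by (simp add: quot_algebra_def FactRing_def nat_pow_def)
next
  case (Suc n)
  then show ?case
    using A_mult[OF nat_pow_closed[OF assms] assms] by (simp add: nat_pow_def)
qed

text \<open>\<open>quot_algebra\<close> copies the fields of \<open>R Quot I\<close> into a record
  of another type, so the group laws are read off from the quotient ring after unfolding.\<close>

lemma abelian_group_A: "abelian_group A"
proof (rule abelian_groupI; unfold quot_algebra_def module.simps ring.simps partial_object.simps)
  note grp = abelian_groupE[OF ring.is_abelian_group[OF quotient_is_ring]]
  fix U V W
  assume U: "U \<in> carrier (R Quot I)"
  show "\<exists>V\<in>carrier (R Quot I). V \<oplus>\<^bsub>R Quot I\<^esub> U = \<zero>\<^bsub>R Quot I\<^esub>"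
    and "\<zero>\<^bsub>R Quot I\<^esub> \<oplus>\<^bsub>R Quot I\<^esub> U = U"
    using U by (rule grp(6), rule grp(5))
  assume V: "V \<in> carrier (R Quot I)"
  show "U \<oplus>\<^bsub>R Quot I\<^esub> V \<in> carrier (R Quot I)"
    and "U \<oplus>\<^bsub>R Quot I\<^esub> V = V \<oplus>\<^bsub>R Quot I\<^esub> U"
    using U V by (rule grp(1), rule grp(4))
  assume W: "W \<in> carrier (R Quot I)"
  show "U \<oplus>\<^bsub>R Quot I\<^esub> V \<oplus>\<^bsub>R Quot I\<^esub> W = U \<oplus>\<^bsub>R Quot I\<^esub> (V \<oplus>\<^bsub>R Quot I\<^esub> W)"
    using U V W by (rule grp(3))
qed (rule abelian_groupE(2)[OF ring.is_abelian_group[OF quotient_is_ring]])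

lemma module_A: "module R A"
proof (rule moduleI[OF is_cring abelian_group_A])
  fix r U assume "r \<in> carrier R" "U \<in> carrier A"
  then show "r \<odot>\<^bsub>A\<^esub> U \<in> carrier A"
    by (auto simp: carrier_A A_smult)
next
  fix r s U assume "r \<in> carrier R" "s \<in> carrier R" "U \<in> carrier A"
  then show "(r \<oplus> s) \<odot>\<^bsub>A\<^esub> U = r \<odot>\<^bsub>A\<^esub> U \<oplus>\<^bsub>A\<^esub> s \<odot>\<^bsub>A\<^esub> U"
    and "r \<otimes> s \<odot>\<^bsub>A\<^esub> U = r \<odot>\<^bsub>A\<^esub> (s \<odot>\<^bsub>A\<^esub> U)"
    by (auto simp: carrier_A A_smult A_add l_distr m_assoc)
next
  fix r U V assume "r \<in> carrier R" "U \<in> carrier A" "V \<in> carrier A"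
  then show "r \<odot>\<^bsub>A\<^esub> (U \<oplus>\<^bsub>A\<^esub> V) = r \<odot>\<^bsub>A\<^esub> U \<oplus>\<^bsub>A\<^esub> r \<odot>\<^bsub>A\<^esub> V"
    by (auto simp: carrier_A A_smult A_add r_distr)
next
  fix U assume "U \<in> carrier A"
  then show "\<one> \<odot>\<^bsub>A\<^esub> U = U"
    by (auto simp: carrier_A A_smult)
qed

end

text \<open>Common source of the projection (h the identity, q = 1) and of the lifted Frobenius maps
  (h the p-th power, q = p). What varies is the reason why h maps J into I.\<close>

lemma quotient_map_semilinear:
  assumes J: "quotient_algebra R J" and I: "quotient_algebra R I"
    and hom: "abelian_group_hom R R h" and hJ: "h ` J \<subseteq> I"
    and hmult: "\<And>r a. \<lbrakk>r \<in> carrier R; a \<in> carrier R\<rbrakk> \<Longrightarrow> h (r \<otimes>\<^bsub>R\<^esub> a) = r [^]\<^bsub>R\<^esub> q \<otimes>\<^bsub>R\<^esub> h a"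
  shows "semilinear_map R (quot_algebra R J) (quot_algebra R I) q (induced_map R I h)"
    and "a \<in> carrier R \<Longrightarrow> induced_map R I h (J +>\<^bsub>R\<^esub> a) = I +>\<^bsub>R\<^esub> h a"
proof -
  interpret J: quotient_algebra R J by fact
  interpret I: quotient_algebra R I by fact
  interpret h: abelian_group_hom R R h by fact
  have coset: "induced_map R I h (J +>\<^bsub>R\<^esub> a) = I +>\<^bsub>R\<^esub> h a" if "a \<in> carrier R" for a
    using that by (rule induced_map_coset[OF hom J.additive_subgroup_axioms I.additive_subgroup_axioms hJ])
  show "a \<in> carrier R \<Longrightarrow> induced_map R I h (J +>\<^bsub>R\<^esub> a) = I +>\<^bsub>R\<^esub> h a"
    by (rule coset)
  show "semilinear_map R (quot_algebra R J) (quot_algebra R I) q (induced_map R I h)"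
  proof (intro semilinear_map.intro semilinear_map_axioms.intro J.module_A I.module_A)
    fix U assume U: "U \<in> carrier J.A"
    then show "induced_map R I h U \<in> carrier I.A"
      by (auto simp: J.carrier_A coset)
    show "induced_map R I h (r \<odot>\<^bsub>J.A\<^esub> U) = r [^]\<^bsub>R\<^esub> q \<odot>\<^bsub>I.A\<^esub> induced_map R I h U"
      if "r \<in> carrier R" for r
      using U that by (auto simp: J.carrier_A coset J.A_smult I.A_smult hmult)
    fix V assume "V \<in> carrier J.A"
    with U show "induced_map R I h (U \<oplus>\<^bsub>J.A\<^esub> V) = induced_map R I h U \<oplus>\<^bsub>I.A\<^esub> induced_map R I h V"
      by (auto simp: J.carrier_A coset J.A_add I.A_add)
  qed
qed

lemma (in cring) frobenius_hom:
  assumes "Factorial_Ring.prime p" "[p] \<cdot> \<one> = \<zero>"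
  shows "abelian_group_hom R R (\<lambda>a. a [^] (p::nat))"
  by (rule additive_imp_abelian_group_hom)
     (simp_all add: abelian_group_axioms prime_char_add_pow assms)

lemma (in cring) id_hom: "abelian_group_hom R R (\<lambda>a. a)"
  by (rule additive_imp_abelian_group_hom) (simp_all add: abelian_group_axioms)

lemma (in cring) cgenideal_pow_subset:
  assumes x: "x \<in> carrier R" and "k \<le> l"
  shows "PIdl (x [^] (l::nat)) \<subseteq> PIdl (x [^] (k::nat))"
proof (rule cgenideal_minimal[OF cgenideal_ideal])
  have "x [^] l = x [^] (l - k) \<otimes> x [^] k"
    using assms by (simp add: nat_pow_mult)
  then show "x [^] l \<in> PIdl (x [^] k)"
    unfolding cgenideal_def using x by blast
qed (use x in simp)

text \<open>(r x^l)^p = r^p x^(l p). The case l = k = 1 makes the Frobenius map of R/x itself an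
  instance.\<close>

lemma (in cring) frobenius_cgenideal:
  assumes x: "x \<in> carrier R" and "k \<le> l * p"
  shows "(\<lambda>a. a [^] (p::nat)) ` (PIdl (x [^] (l::nat))) \<subseteq> PIdl (x [^] (k::nat))"
proof
  fix b assume "b \<in> (\<lambda>a. a [^] p) ` (PIdl (x [^] l))"
  then obtain r where r: "r \<in> carrier R" "b = (r \<otimes> x [^] l) [^] p"
    unfolding cgenideal_def by blast
  then have "b = r [^] p \<otimes> x [^] (l * p)"
    using x by (simp add: nat_pow_distrib nat_pow_pow)
  then have "b \<in> PIdl (x [^] (l * p))"
    unfolding cgenideal_def using r(1) by blast
  then show "b \<in> PIdl (x [^] k)"
    using cgenideal_pow_subset[OF assms] by blast
qed

section \<open>Surjectivity from anti-nilpotency\<close>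

text \<open>\<open>\<rho>\<close> may be any function: every member of a coset goes into N, so the
  union that defines the induced map is N on each coset. Injectivity then leaves room for one coset
  only.\<close>

lemma anti_nilpotent_submodule_eq:
  assumes H: "abelian_group H" and an: "anti_nilpotent R H \<rho>"
    and N: "submodule N R H" and \<rho>: "\<rho> ` carrier H \<subseteq> N"
  shows "N = carrier H"
proof
  have sub: "additive_subgroup N H"
    using N by (simp add: submodule_def additive_subgroupI)
  interpret N: abelian_subgroup N H
    using sub H by (rule abelian_subgroupI3)
  show "N \<subseteq> carrier H"
    by (rule N.a_subset)
  have "F_compatible R H \<rho> N"
    using N \<rho> N.a_subset by (auto simp: F_compatible_def)
  then have inj: "inj_on (induced_map H N \<rho>) (carrier (quot_module H N))"
    using an by (simp add: anti_nilpotent_def)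
  have coset: "N +>\<^bsub>H\<^esub> u \<in> carrier (quot_module H N)" "induced_map H N \<rho> (N +>\<^bsub>H\<^esub> u) = N"
    if u: "u \<in> carrier H" for u
  proof -
    show "N +>\<^bsub>H\<^esub> u \<in> carrier (quot_module H N)"
      using u by (auto simp: quot_module_def A_RCOSETS_def')
    have "N +>\<^bsub>H\<^esub> \<rho> y = N" if "y \<in> N +>\<^bsub>H\<^esub> u" for y
      using that u \<rho> N.a_r_coset_subset_G[OF N.a_subset u] by (intro N.a_rcos_const) blast
    then show "induced_map H N \<rho> (N +>\<^bsub>H\<^esub> u) = N"
      unfolding induced_map_def using N.a_rcos_self[OF u] by auto
  qed
  show "carrier H \<subseteq> N"
  proof
    fix u assume u: "u \<in> carrier H"
    have "N +>\<^bsub>H\<^esub> u = N +>\<^bsub>H\<^esub> \<zero>\<^bsub>H\<^esub>"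
      by (rule inj_onD[OF inj]) (simp_all add: coset u)
    then show "u \<in> N"
      using N.a_rcos_self[OF u] N.a_coset_add_zero[OF N.a_subset] by simp
  qed
qed

theorem theorem4p11:
  fixes R :: "('a, 'r) ring_scheme" and m :: "'a set" and p :: nat
    and fs :: "'a list" and x :: 'a
  assumes "local_ring R m"
    and "Factorial_Ring.prime p" and "has_char R p"
    and "set fs \<subseteq> carrier R" and "ideal_radical R (Idl\<^bsub>R\<^esub> (set fs)) = m"
    and "x \<in> m" and "regular_element R x"
    and "\<And>i::nat. anti_nilpotent R
           (local_cohomology R fs (quot_algebra R (PIdl\<^bsub>R\<^esub> x)) i)
           (natural_frobenius R fs p (quot_algebra R (PIdl\<^bsub>R\<^esub> x)) i)"
  shows "surjective_element R m fs x"
proof -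
  interpret cring R
    using assms(1) by (simp add: local_ring_def)
  note fs = assms(4)
  have x: "x \<in> carrier R"
    using assms(7) by (simp add: regular_element_def)
  have char: "[p] \<cdot>\<^bsub>R\<^esub> \<one>\<^bsub>R\<^esub> = \<zero>\<^bsub>R\<^esub>"
    using assms(3) by (simp add: has_char_def)
  \<comment> \<open>The exponent is explicit also for x itself, so that R/x is \<open>A 1\<close>, a
    member of the same family.\<close>
  define I where "I l = PIdl\<^bsub>R\<^esub> (x [^]\<^bsub>R\<^esub> l)" for l :: nat
  define A where "A l = quot_algebra R (I l)" for l
  define H where "H l i = local_cohomology R fs (A l) i" for l i
  define \<pi> where "\<pi> = quot_proj R (I 1)"
  \<comment> \<open>An induced map is written with its target alone. Hence \<open>F k\<close> serves
    every source \<open>A l\<close> with k <= l p, and \<open>\<pi>\<close> serves every l >=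
    1.\<close>
  define F where "F l = induced_map R (I l) (\<lambda>a. a [^]\<^bsub>R\<^esub> p)" for l
  have I1: "I 1 = PIdl\<^bsub>R\<^esub> x"
    using x by (simp add: I_def)
  have quot: "quotient_algebra R (I l)" for l
    unfolding I_def using x
    by (intro quotient_algebra.intro is_cring cgenideal_ideal) simp
  have frob_mult: "(r \<otimes>\<^bsub>R\<^esub> a) [^]\<^bsub>R\<^esub> p = r [^]\<^bsub>R\<^esub> p \<otimes>\<^bsub>R\<^esub> a [^]\<^bsub>R\<^esub> p"
    if "r \<in> carrier R" "a \<in> carrier R" for r a
    using that by (simp add: nat_pow_distrib)
  have sub: "(\<lambda>a. a) ` I l \<subseteq> I 1" if "1 \<le> l" for l
    using cgenideal_pow_subset[OF x that] by (simp add: I_def)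
  have \<pi>: "semilinear_map R (A l) (A 1) 1 \<pi>"
    and \<pi>_coset: "\<And>a. a \<in> carrier R \<Longrightarrow> \<pi> (I l +>\<^bsub>R\<^esub> a) = I 1 +>\<^bsub>R\<^esub> a"
    if "1 \<le> l" for l
    unfolding A_def \<pi>_def quot_proj_def
    using quotient_map_semilinear[OF quot quot id_hom sub[OF that], of 1] by simp_all
  have F: "semilinear_map R (A l) (A k) p (F k)"
    and F_coset: "\<And>a. a \<in> carrier R \<Longrightarrow> F k (I l +>\<^bsub>R\<^esub> a) = I k +>\<^bsub>R\<^esub> (a [^]\<^bsub>R\<^esub> p)"
    if "k \<le> l * p" for k l
    unfolding A_def F_def
    using quotient_map_semilinear[OF quot quot frobenius_hom[OF assms(2) char]
        frobenius_cgenideal[OF x that, folded I_def] frob_mult] by simp_all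
  have p: "1 \<le> 1 * p"
    using prime_gt_0_nat[OF assms(2)] by simp
  have carrier_A: "carrier (A l) = (\<lambda>a. I l +>\<^bsub>R\<^esub> a) ` carrier R" for l
    unfolding A_def by (rule quotient_algebra.carrier_A[OF quot])
  \<comment> \<open>\<open>natural_frobenius\<close> takes p-th powers in the algebra
    \<open>A 1\<close>, whereas \<open>F 1\<close> takes them on representatives in R. Agreement on
    the carrier makes the former semilinear.\<close>
  have frob_A: "U [^]\<^bsub>A 1\<^esub> p = F 1 U" if "U \<in> carrier (A 1)" for U
  proof -
    from that obtain a where U: "U = I 1 +>\<^bsub>R\<^esub> a" and a: "a \<in> carrier R"
      unfolding carrier_A by (rule imageE)
    have "U [^]\<^bsub>A 1\<^esub> p = I 1 +>\<^bsub>R\<^esub> (a [^]\<^bsub>R\<^esub> p)"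
      unfolding U A_def by (rule quotient_algebra.A_pow[OF quot a])
    also have "\<dots> = F 1 U"
      unfolding U by (rule F_coset[OF p a, symmetric])
    finally show ?thesis .
  qed
  have frob_semilinear: "semilinear_map R (A 1) (A 1) p (\<lambda>U. U [^]\<^bsub>A 1\<^esub> p)"
    using F[OF p] frob_A by (rule semilinear_map_cong)
  \<comment> \<open>Written with \<open>Suc l\<close> so that the induction starts at exponent 1,
    where the projection is the identity on cosets.\<close>
  have surj: "local_cohomology_map R fs (A 1) i 1 \<pi> ` carrier (H (Suc l) i) = carrier (H 1 i)" for l i
  proof (induction l)
    case 0
    have "local_cohomology_map R fs (A 1) i 1 \<pi> U = U" if "U \<in> carrier (H 1 i)" for U
      using that unfolding H_def
      by (intro local_cohomology_map_id[OF \<pi> _ fs]) (auto simp: carrier_A \<pi>_coset)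
    then show ?case
      by simp
  next
    case (Suc l)
    let ?\<pi> = "local_cohomology_map R fs (A 1) i 1 \<pi>"
    let ?\<rho> = "natural_frobenius R fs p (A 1) i"
    \<comment> \<open>p >= 2 gives l + 2 <= 2 (l + 1) <= p (l + 1), so the p-th power gains at least
      one power of x at every stage.\<close>
    have le: "Suc (Suc l) \<le> Suc l * p" "1 \<le> Suc l" "1 \<le> Suc (Suc l)"
      using prime_ge_2_nat[OF assms(2)] mult_le_mono2[of 2 p "Suc l"] by auto
    note F = F[OF le(1)] and \<pi>l = \<pi>[OF le(2)] and \<pi>Sl = \<pi>[OF le(3)]
    note F_hom = cech_semilinear.local_cohomology_map_hom[OF cech_semilinearI[OF F fs]]
    have "?\<pi> ` carrier (H (Suc (Suc l)) i) = carrier (H 1 i)"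
    proof (rule anti_nilpotent_submodule_eq)
      \<comment> \<open>Read off as the domain of an induced homomorphism, here that of the
        Frobenius map.\<close>
      show "abelian_group (H 1 i)"
        using abelian_group_hom.axioms(1)[OF cech_semilinear.local_cohomology_map_hom
            [OF cech_semilinearI[OF frob_semilinear fs]]] by (simp add: H_def)
      show "anti_nilpotent R (H 1 i) ?\<rho>"
        using assms(8)[of i] by (simp only: H_def A_def I1)
      show "submodule (?\<pi> ` carrier (H (Suc (Suc l)) i)) R (H 1 i)"
        unfolding H_def by (rule submodule_local_cohomology_image[OF \<pi>Sl fs])
      show "?\<rho> ` carrier (H 1 i) \<subseteq> ?\<pi> ` carrier (H (Suc (Suc l)) i)"
      proof
        fix V assume "V \<in> ?\<rho> ` carrier (H 1 i)"
        then obtain W where V': "V = ?\<rho> W" and "W \<in> carrier (H 1 i)"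
          by (rule imageE)
        then have "W \<in> ?\<pi> ` carrier (H (Suc l) i)"
          by (simp only: Suc.IH)
        then obtain U where W: "W = ?\<pi> U" and U: "U \<in> carrier (H (Suc l) i)"
          by (rule imageE)
        note V = V'[unfolded W]
        \<comment> \<open>From here on the square is followed: the Frobenius action on the image of
          U is rewritten as the projection of the lifted Frobenius of U, a class of
          R/x^(l+2).\<close>
        have "V = local_cohomology_map R fs (A 1) i (p * 1) (\<lambda>a. \<pi> a [^]\<^bsub>A 1\<^esub> p) U"
          using U unfolding V natural_frobenius_def H_def
          by (rule local_cohomology_map_comp[OF \<pi>l frob_semilinear fs])
        also have "\<dots> = local_cohomology_map R fs (A 1) i (1 * p) (\<lambda>a. \<pi> (F (Suc (Suc l)) a)) U"
          unfolding mult_1 mult_1_right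
        proof (rule local_cohomology_map_cong[OF _ _ _ fs])
          show "semilinear_map R (A (Suc l)) (A 1) p (\<lambda>a. \<pi> a [^]\<^bsub>A 1\<^esub> p)"
            using semilinear_map_comp[OF \<pi>l frob_semilinear] by simp
          show "semilinear_map R (A (Suc l)) (A 1) p (\<lambda>a. \<pi> (F (Suc (Suc l)) a))"
            using semilinear_map_comp[OF F \<pi>Sl] by simp
          show "U \<in> carrier (local_cohomology R fs (A (Suc l)) i)"
            using U by (simp add: H_def)
          fix b assume "b \<in> carrier (A (Suc l))"
          then obtain a where b: "b = I (Suc l) +>\<^bsub>R\<^esub> a" and a: "a \<in> carrier R"
            unfolding carrier_A by (rule imageE)
          have "\<pi> b [^]\<^bsub>A 1\<^esub> p = I 1 +>\<^bsub>R\<^esub> (a [^]\<^bsub>R\<^esub> p)"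
            unfolding b \<pi>_coset[OF le(2) a] A_def by (rule quotient_algebra.A_pow[OF quot a])
          also have "\<dots> = \<pi> (F (Suc (Suc l)) b)"
            unfolding b F_coset[OF le(1) a] by (rule \<pi>_coset[OF le(3), symmetric]) (simp add: a)
          finally show "\<pi> b [^]\<^bsub>A 1\<^esub> p = \<pi> (F (Suc (Suc l)) b)" .
        qed
        also have "\<dots> = ?\<pi> (local_cohomology_map R fs (A (Suc (Suc l))) i p (F (Suc (Suc l))) U)"
          using U unfolding H_def by (rule local_cohomology_map_comp[OF F \<pi>Sl fs, symmetric])
        finally show "V \<in> ?\<pi> ` carrier (H (Suc (Suc l)) i)"
          using abelian_group_hom.hom_closed[OF F_hom] U by (auto simp: H_def)
      qed
    qed
    then show ?case .
  qed
  show ?thesis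
    unfolding surjective_element_def
  proof (intro conjI allI impI assms(6,7))
    fix l i :: nat assume "l > 0"
    then obtain k where "l = Suc k"
      using gr0_conv_Suc by blast
    then show "local_cohomology_map R fs (quot_algebra R (PIdl\<^bsub>R\<^esub> x)) i 1 (quot_proj R (PIdl\<^bsub>R\<^esub> x)) `
         carrier (local_cohomology R fs (quot_algebra R (PIdl\<^bsub>R\<^esub> (x [^]\<^bsub>R\<^esub> l))) i)
       = carrier (local_cohomology R fs (quot_algebra R (PIdl\<^bsub>R\<^esub> x)) i)"
      using surj[of i k] by (simp only: H_def A_def \<pi>_def I1 I_def[symmetric])
  qed
qed

end
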